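(* Assume $(S-1)\alpha\in\ell^1$. Then $$\int_0^{2\pi}(1-\cos\theta)^3\log w(\theta)\frac{d\theta}{2\pi}>-\infty\iff\alpha\in\ell^8.$$
   Context: $\mu$ is a probability measure with infinite support on the unit circle (identified with $[0,2\pi]$ via $e^{i\theta}\mapsto\theta$), with Lebesgue decomposition $d\mu(\theta)=w(\theta)\frac{d\theta}{2\pi}+d\mu_s(\theta)$. $\Phi_n$ are its monic orthogonal polynomials, and its sequence of Verblunsky coefficients is $\alpha=(\alpha_n)_{n\ge0}$, $\alpha_n=-\overline{\Phi_{n+1}(0)}\in\mathbb{D}$. $S$ is the left shift on sequences, $(S\alpha)_n=\alpha_{n+1}$. The integral is well defined in $[-\infty,\infty)$. *)

theory Defs
  imports "HOL-Probability.Probability" "HOL-Computational_Algebra.Polynomial"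
begin

text \<open>
  Measures on the unit circle are Borel measures on the complex plane that give no mass to the
  complement of \<^term>\<open>sphere 0 1 :: complex set\<close>; the parametrisation by an angle is \<^const>\<open>cis\<close>.
\<close>

definition measure_support :: "'a::topological_space measure \<Rightarrow> 'a set" where
  "measure_support M = {x. \<forall>U. open U \<longrightarrow> x \<in> U \<longrightarrow> emeasure M U > 0}"

definition nontrivial_circle_prob :: "complex measure \<Rightarrow> bool" where
  "nontrivial_circle_prob \<mu> \<longleftrightarrow>
     prob_space \<mu> \<and> sets \<mu> = sets borel \<and> emeasure \<mu> (- sphere 0 1) = 0 \<and>
     infinite (measure_support \<mu>)"

text \<open>The normalised Lebesgue measure \<open>d\<theta>/2\<pi>\<close> on \<open>[0,2\<pi>]\<close>, as a measure on the reals.\<close>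

definition angle_measure :: "real measure" where
  "angle_measure = uniform_measure lborel {0..2*pi}"

definition mutually_singular :: "'a measure \<Rightarrow> 'a measure \<Rightarrow> bool" where
  "mutually_singular M N \<longleftrightarrow>
     (\<exists>A\<in>sets M \<inter> sets N. emeasure M A = 0 \<and> emeasure N (space N - A) = 0)"

text \<open>\<open>d\<mu> = w(\<theta>) d\<theta>/2\<pi> + d\<mu>\<^sub>s\<close>.  Values of \<open>w\<close> outside \<open>[0,2\<pi>]\<close> play no role.\<close>

definition circle_lebesgue_decomposition ::
  "complex measure \<Rightarrow> (real \<Rightarrow> real) \<Rightarrow> complex measure \<Rightarrow> bool" where
  "circle_lebesgue_decomposition \<mu> w \<mu>\<^sub>s \<longleftrightarrow>
     w \<in> borel_measurable borel \<and> (\<forall>\<theta>\<in>{0..2*pi}. 0 \<le> w \<theta>) \<and>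
     sets \<mu>\<^sub>s = sets borel \<and>
     mutually_singular (distr angle_measure borel cis) \<mu>\<^sub>s \<and>
     (\<forall>A\<in>sets borel. emeasure \<mu> A =
        emeasure (distr (density angle_measure (\<lambda>\<theta>. ennreal (w \<theta>))) borel cis) A
        + emeasure \<mu>\<^sub>s A)"

definition monic_opuc :: "complex measure \<Rightarrow> (nat \<Rightarrow> complex poly) \<Rightarrow> bool" where
  "monic_opuc \<mu> \<Phi> \<longleftrightarrow>
     (\<forall>n. degree (\<Phi> n) = n \<and> lead_coeff (\<Phi> n) = 1) \<and>
     (\<forall>m n. m \<noteq> n \<longrightarrow> (LINT z|\<mu>. cnj (poly (\<Phi> m) z) * poly (\<Phi> n) z) = 0)"

definition verblunsky :: "(nat \<Rightarrow> complex poly) \<Rightarrow> nat \<Rightarrow> complex" where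
  "verblunsky \<Phi> n = - cnj (poly (\<Phi> (Suc n)) 0)"

definition left_shift :: "(nat \<Rightarrow> 'a) \<Rightarrow> nat \<Rightarrow> 'a" where
  "left_shift a = (\<lambda>n. a (Suc n))"

definition ell :: "real \<Rightarrow> (nat \<Rightarrow> complex) set" where
  "ell p = {a. summable (\<lambda>n. norm (a n) powr p)}"

text \<open>The library's \<^const>\<open>ln\<close> has the dummy value \<open>ln 0 = 0\<close>; here \<open>log 0 = -\<infinity>\<close>.\<close>

definition elog :: "real \<Rightarrow> ereal" where
  "elog x = (if x \<le> 0 then - \<infinity> else ereal (ln x))"

text \<open>
  Integral of an extended real function, as the integral of the positive part minus the integral of
  the negative part (\<^const>\<open>e2ennreal\<close> sends negative values to \<open>0\<close>).  It is meaningful whenever one of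
  the two is finite; for the integrands used here the positive part has finite integral because
  \<open>log w \<le> w\<close> and \<open>w\<close> is integrable.
\<close>

definition ext_integral :: "'a measure \<Rightarrow> ('a \<Rightarrow> ereal) \<Rightarrow> ereal" where
  "ext_integral M f =
     enn2ereal (\<integral>\<^sup>+x. e2ennreal (f x) \<partial>M) - enn2ereal (\<integral>\<^sup>+x. e2ennreal (- f x) \<partial>M)"

end

theory Submission
  imports Defs "HOL-Complex_Analysis.Complex_Analysis"
begin

text \<open>
  Let \<open>w\<^sub>n = \<parallel>\<Phi>\<^sub>n\<parallel>\<^sup>2 / |\<Phi>\<^sub>n\<^sup>*|\<^sup>2\<close> be the Bernstein--Szego weights, whose measures share the first \<open>n\<close>
  moments with \<open>\<mu>\<close>, and let \<open>F\<^sub>n\<close> be the integral of \<open>(1 - cos \<theta>)\<^sup>3 log w\<^sub>n\<close>.  The inequality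
  \<open>log x \<le> x - 1\<close> shows that the integral of the theorem is finite iff \<open>F\<^sub>n\<close> is bounded below: apply it
  to \<open>w / w\<^sub>n\<close>, whose integral is at most \<open>\<integral> |\<phi>\<^sub>n|\<^sup>2 d\<mu> = 1\<close>, in one direction, and to \<open>w\<^sub>n h\<close> for positive
  trigonometric polynomials \<open>h\<close> approximating a truncation of \<open>1/w\<close> in the other.  With
  \<open>b\<^sub>n = \<Phi>\<^sub>n / \<Phi>\<^sub>n\<^sup>*\<close> one has \<open>\<Phi>\<^sup>*\<^bsub>n+1\<^esub> = \<Phi>\<^sub>n\<^sup>* (1 - \<alpha>\<^sub>n z b\<^sub>n)\<close>, so \<open>F\<^bsub>n+1\<^esub> - F\<^sub>n\<close> is \<open>5/2 log (1 - |\<alpha>\<^sub>n|\<^sup>2)\<close>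
  plus a polynomial in \<open>\<alpha>\<^sub>n, \<dots>, \<alpha>\<^bsub>n-3\<^esub>\<close>, which by bounded variation may be evaluated on the diagonal at the
  cost of a summable error.  There it equals \<open>5/2 (x + x\<^sup>2/2 + x\<^sup>3/3)\<close> with \<open>x = |\<alpha>\<^sub>n|\<^sup>2\<close>, which cancels the
  logarithm up to order \<open>x\<^sup>4 = |\<alpha>\<^sub>n|\<^sup>8\<close>.
\<close>

section \<open>Mean values on the unit circle\<close>

text \<open>The exponent 8 can be read off from constant coefficients a. For small a the
  Bernstein--Szego weights then decay exponentially on a gap around \<theta> = 0 of length of order
  |a|, at a rate of order |a|, while (1 - cos \<theta>)^3 is of order |a|^6 there. A step thus costs
  entropy of order |a|^8, in agreement with the cancellation up to x^3. The passage between F_n and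
  w rests on moments alone: a trigonometric polynomial has the same integral against \<mu> and
  against w_n for large n. The obstacle is the singular part of \<mu>, which log w does not see. In
  one direction it is dropped by an inequality; in the other the test function h is kept equal to 1
  on a Lebesgue null set that carries it. Such an h is merely measurable, so the inequality for
  trigonometric polynomials is extended to continuous and then to bounded measurable functions, the
  last step by an approximation in L^1 of Lebesgue measure and of \<mu> at once.\<close>

lemma angle_measure_density:
  "angle_measure = density lborel (\<lambda>\<theta>. ennreal (indicator {0..2*pi} \<theta> / (2*pi)))"
  unfolding angle_measure_def uniform_measure_def
  by (intro density_cong) (auto simp: indicator_def divide_ennreal ennreal_1[symmetric] simp del: ennreal_1)

lemma prob_space_angle_measure: "prob_space angle_measure"
  unfolding angle_measure_def by (rule prob_space_uniform_measure) auto

interpretation angle: prob_space angle_measure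
  by (rule prob_space_angle_measure)

lemma sets_angle_measure [simp, measurable_cong]: "sets angle_measure = sets borel"
  by (simp add: angle_measure_def)

lemma space_angle_measure [simp]: "space angle_measure = UNIV"
  by (simp add: angle_measure_def)

lemma angle_continuous:
  fixes g :: "real \<Rightarrow> 'a::euclidean_space"
  assumes "continuous_on UNIV g"
  shows "integrable angle_measure g"
    and "(LINT \<theta>|angle_measure. g \<theta>) = (1 / (2*pi)) *\<^sub>R integral {0..2*pi} g"
proof -
  have [measurable]: "g \<in> borel_measurable borel"
    using assms by (rule borel_measurable_continuous_onI)
  have "set_integrable lborel {0..2*pi} g"
    unfolding set_integrable_def using assms
    by (intro borel_integrable_compact) (auto intro: continuous_on_subset)
  then have i: "integrable lborel (\<lambda>\<theta>. indicator {0..2*pi} \<theta> *\<^sub>R g \<theta>)"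
    by (simp add: set_integrable_def)
  have eq: "(indicator {0..2*pi} \<theta> / (2*pi)) *\<^sub>R g \<theta> = (1/(2*pi)) *\<^sub>R (indicator {0..2*pi} \<theta> *\<^sub>R g \<theta>)" for \<theta>
    by simp
  show "integrable angle_measure g"
    unfolding angle_measure_density
    by (subst integrable_density) (use i in \<open>simp_all add: eq del: scaleR_scaleR\<close>)
  have "(LINT \<theta>|angle_measure. g \<theta>) = (LINT \<theta>|lborel. (indicator {0..2*pi} \<theta> / (2*pi)) *\<^sub>R g \<theta>)"
    unfolding angle_measure_density by (subst integral_density) auto
  also have "\<dots> = (1 / (2*pi)) *\<^sub>R (LINT \<theta>|lborel. indicator {0..2*pi} \<theta> *\<^sub>R g \<theta>)"
    unfolding eq by (rule integral_scaleR_right)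
  also have "(LINT \<theta>|lborel. indicator {0..2*pi} \<theta> *\<^sub>R g \<theta>) = integral {0..2*pi} g"
    using set_borel_integral_eq_integral(2)[OF \<open>set_integrable lborel {0..2*pi} g\<close>]
    by (simp add: set_lebesgue_integral_def)
  finally show "(LINT \<theta>|angle_measure. g \<theta>) = (1 / (2*pi)) *\<^sub>R integral {0..2*pi} g" .
qed

text \<open>Continuity up to the boundary allows Cauchy's formula on the unit circle itself. Since
  \<open>Q n\<close> has no zeros in the closed disc, its reciprocal and the Schur functions below
  belong to this class.\<close>

definition disc_algebra :: "(complex \<Rightarrow> complex) set" where
  "disc_algebra = {f. continuous_on (cball 0 1) f \<and> f holomorphic_on ball 0 1}"

lemma disc_algebra_intros:
  "(\<lambda>z. c) \<in> disc_algebra" "(\<lambda>z. z) \<in> disc_algebra" "(\<lambda>z. poly p z) \<in> disc_algebra"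
  "f \<in> disc_algebra \<Longrightarrow> g \<in> disc_algebra \<Longrightarrow> (\<lambda>z. f z + g z) \<in> disc_algebra"
  "f \<in> disc_algebra \<Longrightarrow> g \<in> disc_algebra \<Longrightarrow> (\<lambda>z. f z - g z) \<in> disc_algebra"
  "f \<in> disc_algebra \<Longrightarrow> g \<in> disc_algebra \<Longrightarrow> (\<lambda>z. f z * g z) \<in> disc_algebra"
  "f \<in> disc_algebra \<Longrightarrow> (\<lambda>z. - f z) \<in> disc_algebra"
  "f \<in> disc_algebra \<Longrightarrow> (\<lambda>z. f z ^ n) \<in> disc_algebra"
  unfolding disc_algebra_def by (auto intro!: continuous_intros holomorphic_intros poly_holomorphic_on)

lemma disc_algebra_divide:
  assumes "f \<in> disc_algebra" "g \<in> disc_algebra" "\<And>z. norm z \<le> 1 \<Longrightarrow> g z \<noteq> 0"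
  shows "(\<lambda>z. f z / g z) \<in> disc_algebra"
  using assms unfolding disc_algebra_def
  by (auto intro!: continuous_intros holomorphic_intros)

lemma disc_algebra_cis_continuous:
  assumes "f \<in> disc_algebra"
  shows "continuous_on UNIV (\<lambda>\<theta>. f (cis \<theta>))"
proof -
  have "continuous_on (cball 0 1) f" using assms by (simp add: disc_algebra_def)
  then show ?thesis
    by (rule continuous_on_compose2) (auto intro!: continuous_intros)
qed

lemma mean_value_circle:
  assumes "f \<in> disc_algebra"
  shows "(LINT \<theta>|angle_measure. f (cis \<theta>)) = f 0"
proof -
  have "((\<lambda>u. f u/(u-0)) has_contour_integral (2 * of_real pi * \<i> * f 0)) (circlepath 0 1)"
    using assms by (intro Cauchy_integral_circlepath) (auto simp: disc_algebra_def)
  then have "((\<lambda>t. f (cis t) / cis t * \<i> * cis t) has_integral (2 * of_real pi * \<i> * f 0)) {0..2*pi}"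
    unfolding circlepath_def by (subst (asm) has_contour_integral_part_circlepath_iff) auto
  then have "((\<lambda>t. f (cis t) * \<i>) has_integral (2 * of_real pi * \<i> * f 0)) {0..2*pi}"
    by (simp add: field_simps)
  then have "((\<lambda>t. f (cis t) * \<i> * (-\<i>)) has_integral (2 * of_real pi * \<i> * f 0 * (-\<i>))) {0..2*pi}"
    by (rule has_integral_mult_left)
  then have "((\<lambda>t. f (cis t)) has_integral (2 * of_real pi * f 0)) {0..2*pi}"
    by (simp add: mult_ac)
  then have "integral {0..2*pi} (\<lambda>t. f (cis t)) = 2 * of_real pi * f 0"
    by (rule integral_unique)
  then show ?thesis
    using angle_continuous(2)[OF disc_algebra_cis_continuous[OF assms]]
    by (simp add: scaleR_conv_of_real)
qed

lemma mean_value_circle_power: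
  assumes "f \<in> disc_algebra" "k > 0"
  shows "(LINT \<theta>|angle_measure. cis \<theta> ^ k * f (cis \<theta>)) = 0"
  using mean_value_circle[of "\<lambda>z. z ^ k * f z"] assms by (simp add: disc_algebra_intros)

section \<open>The Szego recursion\<close>

locale circle_measure = finite_measure M for M :: "complex measure" +
  assumes sets_M [simp, measurable_cong]: "sets M = sets borel"
    and AE_norm: "AE z in M. norm z = 1"
begin

lemma space_M [simp]: "space M = UNIV"
  using sets_eq_imp_space_eq[OF sets_M] by simp

text \<open>A continuous function on the plane may be unbounded, but it is bounded on the compact
  circle, which carries the measure.\<close>

lemma integrable_continuous:
  fixes g :: "complex \<Rightarrow> 'a::{banach, second_countable_topology}"
  assumes "continuous_on UNIV g"
  shows "integrable M g"
proof -
  have [measurable]: "g \<in> borel_measurable borel"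
    using assms by (rule borel_measurable_continuous_onI)
  have "compact (g ` sphere 0 1)"
    by (intro compact_continuous_image continuous_on_subset[OF assms]) auto
  then obtain B where B: "\<And>z. z \<in> sphere 0 1 \<Longrightarrow> norm (g z) \<le> B"
    by (meson compact_imp_bounded bounded_iff imageI)
  show ?thesis
    by (rule integrable_const_bound[of _ B]) (use AE_norm B in \<open>auto elim!: eventually_mono\<close>)
qed

lemma integral_circle_cong:
  fixes f g :: "complex \<Rightarrow> 'a::{banach, second_countable_topology}"
  assumes "\<And>z. norm z = 1 \<Longrightarrow> f z = g z" "continuous_on UNIV f" "continuous_on UNIV g"
  shows "(LINT z|M. f z) = (LINT z|M. g z)"
proof (rule integral_cong_AE)
  show "f \<in> borel_measurable M" "g \<in> borel_measurable M"
    using assms(2,3)[THEN borel_measurable_continuous_onI] by simp_all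
  show "AE z in M. f z = g z"
    using AE_norm assms(1) by (auto elim!: eventually_mono)
qed

end

text \<open>The second component is the reversed polynomial \<open>\<Phi>\<^sub>n\<^sup>*\<close>.\<close>

fun szego :: "(nat \<Rightarrow> complex) \<Rightarrow> nat \<Rightarrow> complex poly \<times> complex poly" where
  "szego \<alpha> 0 = (1, 1)"
| "szego \<alpha> (Suc n) =
     (let (p, q) = szego \<alpha> n
      in (pCons 0 p - smult (cnj (\<alpha> n)) q, q - smult (\<alpha> n) (pCons 0 p)))"

text \<open>The coefficients are arbitrary here: for the given measure the bound |\<alpha>_n| < 1 is
  itself derived from orthogonality by means of the recursion.\<close>

locale szego_seq =
  fixes \<alpha> :: "nat \<Rightarrow> complex"
begin

definition P :: "nat \<Rightarrow> complex poly" where "P n = fst (szego \<alpha> n)"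
definition Q :: "nat \<Rightarrow> complex poly" where "Q n = snd (szego \<alpha> n)"

lemma PQ_0 [simp]: "P 0 = 1" "Q 0 = 1"
  by (simp_all add: P_def Q_def)

lemma P_Suc: "P (Suc n) = pCons 0 (P n) - smult (cnj (\<alpha> n)) (Q n)"
  and Q_Suc: "Q (Suc n) = Q n - smult (\<alpha> n) (pCons 0 (P n))"
  by (simp_all add: P_def Q_def split_beta)

lemma poly_P_Suc: "poly (P (Suc n)) z = z * poly (P n) z - cnj (\<alpha> n) * poly (Q n) z"
  and poly_Q_Suc: "poly (Q (Suc n)) z = poly (Q n) z - \<alpha> n * (z * poly (P n) z)"
  by (simp_all add: P_Suc Q_Suc)

lemma degree_PQ: "degree (P n) \<le> n \<and> degree (Q n) \<le> n"
proof (induction n)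
  case (Suc n)
  have *: "degree (pCons 0 (P n)) \<le> Suc n"
    using Suc by (auto simp: degree_pCons_eq_if)
  have "degree (P (Suc n)) \<le> Suc n"
    unfolding P_Suc using * Suc
    by (intro degree_diff_le order.trans[OF degree_smult_le]) auto
  moreover have "degree (Q (Suc n)) \<le> Suc n"
    unfolding Q_Suc using * Suc
    by (intro degree_diff_le order.trans[OF degree_smult_le]) auto
  ultimately show ?case by simp
qed simp

lemma coeff_P_top: "coeff (P n) n = 1"
proof (induction n)
  case (Suc n)
  have "coeff (Q n) (Suc n) = 0"
    using degree_PQ[of n] by (intro coeff_eq_0) simp
  then show ?case using Suc by (simp add: P_Suc)
qed simp

lemma degree_P: "degree (P n) = n"
  using degree_PQ[of n] coeff_P_top[of n] by (metis le_antisym le_degree zero_neq_one)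

lemma poly_Q_0: "poly (Q n) 0 = 1"
  by (induction n) (simp_all add: poly_Q_Suc)

lemma Q_circle:
  assumes "norm z = 1"
  shows "poly (Q n) z = z ^ n * cnj (poly (P n) z)"
proof (induction n)
  case (Suc n)
  have zz: "z * cnj z = 1"
    using assms by (simp add: complex_norm_square[symmetric])
  have pn: "z ^ n * (cnj z) ^ n = 1"
    using zz by (simp flip: power_mult_distrib)
  have "z ^ Suc n * cnj (poly (P (Suc n)) z)
      = (z * cnj z) * (z ^ n * cnj (poly (P n) z))
        - \<alpha> n * z * (z ^ n * (cnj z) ^ n) * poly (P n) z"
    by (simp add: poly_P_Suc Suc.IH algebra_simps)
  also have "\<dots> = poly (Q (Suc n)) z"
    by (simp only: zz pn Suc.IH[symmetric] poly_Q_Suc) simp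
  finally show ?case by simp
qed simp

definition rho2 :: "nat \<Rightarrow> real" where "rho2 n = 1 - (norm (\<alpha> n))\<^sup>2"

definition norm_prod :: "nat \<Rightarrow> real" where "norm_prod n = (\<Prod>j<n. rho2 j)"

end

locale verblunsky_seq = szego_seq +
  assumes norm_alpha: "norm (\<alpha> n) < 1"
begin

text \<open>Nonvanishing of \<open>Q (Suc n)\<close> needs |\<open>P n\<close>| <=
  |\<open>Q n\<close>|, so both statements go through one induction. The inequality is inherited
  because a Szego step multiplies |q|^2 - |z p|^2 by 1 - |a|^2.\<close>

lemma Q_dominates:
  assumes "norm z \<le> 1"
  shows "poly (Q n) z \<noteq> 0 \<and> norm (poly (P n) z) \<le> norm (poly (Q n) z)"
proof (induction n)
  case (Suc n)
  define p q a where "p = poly (P n) z" and "q = poly (Q n) z" and "a = \<alpha> n"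
  have q: "q \<noteq> 0" and pq: "norm p \<le> norm q" and a: "norm a < 1"
    using Suc norm_alpha by (auto simp: p_def q_def a_def)
  have zp: "norm (z * p) \<le> norm q"
    using mult_mono[OF assms pq] by (simp add: norm_mult)
  have "norm (a * (z * p)) \<le> norm a * norm q"
    using zp by (simp add: norm_mult mult_left_mono)
  also have "\<dots> < norm q" using q a by simp
  finally have 1: "q - a * (z * p) \<noteq> 0" by auto
  have "(norm (q - a * (z * p)))\<^sup>2 - (norm (z * p - cnj a * q))\<^sup>2
      = (1 - (norm a)\<^sup>2) * ((norm q)\<^sup>2 - (norm (z * p))\<^sup>2)"
  proof -
    have "complex_of_real ((norm (q - a * (z * p)))\<^sup>2 - (norm (z * p - cnj a * q))\<^sup>2)
        = complex_of_real ((1 - (norm a)\<^sup>2) * ((norm q)\<^sup>2 - (norm (z * p))\<^sup>2))"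
      by (simp only: of_real_diff of_real_mult of_real_1 complex_norm_square complex_cnj_diff
          complex_cnj_mult complex_cnj_cnj) (simp add: algebra_simps)
    then show ?thesis by (simp only: of_real_eq_iff)
  qed
  also have "\<dots> \<ge> 0"
    using power_le_one[of "norm a" 2] power_mono[OF zp, of 2] a
    by (intro mult_nonneg_nonneg) (simp_all del: norm_mult)
  finally have "(norm (z * p - cnj a * q))\<^sup>2 \<le> (norm (q - a * (z * p)))\<^sup>2" by simp
  then have "norm (z * p - cnj a * q) \<le> norm (q - a * (z * p))"
    by (rule power2_le_imp_le) simp
  with 1 show ?case by (simp add: poly_P_Suc poly_Q_Suc p_def q_def a_def)
qed simp

lemma Q_nonzero: "norm z \<le> 1 \<Longrightarrow> poly (Q n) z \<noteq> 0"
  using Q_dominates by blast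

lemma rho2_pos: "rho2 n > 0"
  using norm_alpha[of n] by (simp add: rho2_def abs_square_less_1)

lemma norm_prod_pos: "norm_prod n > 0"
  by (auto simp: norm_prod_def intro!: prod_pos rho2_pos)

end

section \<open>Orthogonality and norms along the recursion\<close>

locale szego_circle_measure = szego_seq \<alpha> + circle_measure M
  for \<alpha> :: "nat \<Rightarrow> complex" and M :: "complex measure"
begin

text \<open>Stated for a single degree and against powers of z, since the Bernstein--Szego measure
  of order n is at first known to satisfy it only for \<open>P n\<close>.\<close>

definition orth :: "nat \<Rightarrow> bool" where
  "orth n \<longleftrightarrow> (\<forall>j<n. (LINT z|M. cnj z ^ j * poly (P n) z) = 0)"

text \<open>On the circle reversal is conjugation followed by multiplication by z^m. Vanishing
  moments of \<open>P m\<close> against 1, ..., z^(m-1) thus become those of \<open>Q m\<close>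
  against z, ..., z^m.\<close>

lemma integral_star:
  assumes "j \<le> m"
  shows "(LINT z|M. cnj z ^ j * poly (Q m) z) = cnj (LINT z|M. cnj z ^ (m - j) * poly (P m) z)"
proof -
  have "cnj z ^ j * poly (Q m) z = cnj (cnj z ^ (m - j) * poly (P m) z)" if "norm z = 1" for z
  proof -
    have zz: "z * cnj z = 1"
      using that by (simp add: complex_norm_square[symmetric])
    have "cnj z ^ j * z ^ m = (z * cnj z) ^ j * z ^ (m - j)"
      using assms by (simp add: power_mult_distrib mult_ac flip: power_add)
    then show ?thesis using that zz by (simp add: Q_circle mult.assoc[symmetric])
  qed
  then have "(LINT z|M. cnj z ^ j * poly (Q m) z) = (LINT z|M. cnj (cnj z ^ (m - j) * poly (P m) z))"
    by (intro integral_circle_cong) (auto intro!: continuous_intros)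
  then show ?thesis by (simp only: Bochner_Integration.integral_cnj)
qed

lemma integrable_monom_poly: "integrable M (\<lambda>z. cnj z ^ j * poly p z)"
  by (intro integrable_continuous continuous_intros)

lemma integral_shift: "(LINT z|M. cnj z ^ Suc j * poly (pCons 0 p) z) = (LINT z|M. cnj z ^ j * poly p z)"
proof (rule integral_circle_cong)
  fix z :: complex assume "norm z = 1"
  then have "z * cnj z = 1" by (simp add: complex_norm_square[symmetric])
  moreover have "cnj z ^ Suc j * poly (pCons 0 p) z = (z * cnj z) * (cnj z ^ j * poly p z)"
    by simp
  ultimately show "cnj z ^ Suc j * poly (pCons 0 p) z = cnj z ^ j * poly p z" by simp
qed (auto intro!: continuous_intros)

lemma integral_poly_diff: "(LINT z|M. cnj z ^ j * poly (p - smult c q) z)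
    = (LINT z|M. cnj z ^ j * poly p z) - c * (LINT z|M. cnj z ^ j * poly q z)"
proof -
  have "(LINT z|M. cnj z ^ j * poly (p - smult c q) z)
      = (LINT z|M. cnj z ^ j * poly p z - c * (cnj z ^ j * poly q z))"
    by (simp add: algebra_simps)
  also have "\<dots> = (LINT z|M. cnj z ^ j * poly p z) - (LINT z|M. c * (cnj z ^ j * poly q z))"
    by (intro Bochner_Integration.integral_diff integrable_monom_poly integrable_mult_right)
  finally show ?thesis by simp
qed

lemma of_real_rho2: "of_real (rho2 k) = 1 - cnj (\<alpha> k) * \<alpha> k"
  unfolding rho2_def of_real_diff complex_norm_square by (simp add: mult.commute)

text \<open>Pairing the Szego step with 1 gives <1, z \<Phi>_k> in terms of \<alpha>_k, because the
  left side vanishes by orthogonality. Its conjugate is the pairing of z^(k+1) with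
  \<open>Q k\<close>, the only unknown when the step is paired with z^(k+1). The relation holds for
  any \<alpha>_k and so can later yield |\<alpha>_k| < 1.\<close>

lemma orth_Suc_norm:
  assumes "orth (Suc k)"
  shows "(LINT z|M. cnj z ^ Suc k * poly (P (Suc k)) z)
           = of_real (rho2 k) * (LINT z|M. cnj z ^ k * poly (P k) z)"
proof -
  let ?N = "LINT z|M. cnj z ^ k * poly (P k) z"
  have "0 = (LINT z|M. cnj z ^ 0 * poly (P (Suc k)) z)"
    using assms unfolding orth_def by auto
  also have "\<dots> = (LINT z|M. cnj z ^ 0 * poly (pCons 0 (P k)) z) - cnj (\<alpha> k) * cnj ?N"
    unfolding P_Suc integral_poly_diff using integral_star[of 0 k] by simp
  finally have e: "(LINT z|M. cnj z ^ 0 * poly (pCons 0 (P k)) z) = cnj (\<alpha> k) * cnj ?N" by simp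
  have "(LINT z|M. cnj z ^ Suc k * poly (Q k) z) = (LINT z|M. cnj (cnj z ^ 0 * poly (pCons 0 (P k)) z))"
  proof (rule integral_circle_cong)
    fix z :: complex assume 1: "norm z = 1"
    then have zz: "z * cnj z = 1" by (simp add: complex_norm_square[symmetric])
    have "cnj z ^ Suc k * poly (Q k) z = (z * cnj z) ^ k * (cnj z * cnj (poly (P k) z))"
      by (simp add: Q_circle[OF 1] power_mult_distrib)
    then show "cnj z ^ Suc k * poly (Q k) z = cnj (cnj z ^ 0 * poly (pCons 0 (P k)) z)"
      by (simp add: zz)
  qed (auto intro!: continuous_intros)
  also have "\<dots> = \<alpha> k * ?N"
    by (simp only: Bochner_Integration.integral_cnj e) simp
  finally have "(LINT z|M. cnj z ^ Suc k * poly (P (Suc k)) z) = ?N - cnj (\<alpha> k) * (\<alpha> k * ?N)"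
    unfolding P_Suc integral_poly_diff integral_shift by simp
  then show "(LINT z|M. cnj z ^ Suc k * poly (P (Suc k)) z) = of_real (rho2 k) * ?N"
    by (simp add: of_real_rho2 algebra_simps)
qed

end

locale verblunsky_circle_measure = verblunsky_seq \<alpha> + szego_circle_measure \<alpha> M
  for \<alpha> :: "nat \<Rightarrow> complex" and M :: "complex measure"
begin

text \<open>The inverse Szego recursion expresses \<open>z \<Phi>\<^sub>k\<close> through \<open>\<Phi>\<^bsub>k+1\<^esub>\<close> and \<open>\<Phi>\<^bsub>k+1\<^esub>\<^sup>*\<close>.\<close>

lemma orth_Suc_imp_orth:
  assumes "orth (Suc k)"
  shows "orth k"
proof -
  have recover: "smult (of_real (rho2 k)) (pCons 0 (P k)) = P (Suc k) - smult (- cnj (\<alpha> k)) (Q (Suc k))"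
    unfolding of_real_rho2 P_Suc Q_Suc by (simp add: smult_diff_left smult_diff_right)
  have starz: "(LINT z|M. cnj z ^ j * poly (Q (Suc k)) z) = 0" if "1 \<le> j" "j \<le> Suc k" for j
    using that assms unfolding orth_def by (subst integral_star) auto
  have z: "(LINT z|M. cnj z ^ j * poly (P (Suc k)) z) = 0" if "j \<le> k" for j
    using assms that unfolding orth_def by auto
  show "orth k"
    unfolding orth_def
  proof (intro allI impI)
    fix j assume "j < k"
    have "of_real (rho2 k) * (LINT z|M. cnj z ^ j * poly (P k) z)
        = of_real (rho2 k) * (LINT z|M. cnj z ^ Suc j * poly (pCons 0 (P k)) z)"
      by (simp only: integral_shift)
    also have "\<dots> = (LINT z|M. cnj z ^ Suc j * poly (smult (of_real (rho2 k)) (pCons 0 (P k))) z)"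
      using integral_poly_diff[of "Suc j" 0 "- of_real (rho2 k)" "pCons 0 (P k)"] by simp
    also have "\<dots> = 0"
      unfolding recover integral_poly_diff using \<open>j < k\<close> starz[of "Suc j"] z[of "Suc j"] by simp
    finally show "(LINT z|M. cnj z ^ j * poly (P k) z) = 0"
      using rho2_pos[of k] by simp
  qed
qed

lemma orth_le: "orth n \<Longrightarrow> k \<le> n \<Longrightarrow> orth k"
  by (induction n) (auto simp: le_Suc_eq dest: orth_Suc_imp_orth)

lemma orth_norm:
  "orth n \<Longrightarrow> (LINT z|M. cnj z ^ n * poly (P n) z) = of_real (norm_prod n) * of_real (measure M UNIV)"
proof (induction n)
  case 0
  then show ?case by (simp add: norm_prod_def scaleR_conv_of_real)
next
  case (Suc n)
  then show ?case using orth_Suc_norm[OF Suc.prems] orth_Suc_imp_orth[OF Suc.prems] by (simp add: norm_prod_def)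
qed

lemma orth_moment:
  assumes "orth k" "0 < k"
  shows "(LINT z|M. z ^ k) = - (\<Sum>i<k. coeff (P k) i * (LINT z|M. z ^ i))"
proof -
  have "0 = (LINT z|M. cnj z ^ 0 * poly (P k) z)"
    using assms by (auto simp: orth_def)
  also have "\<dots> = (LINT z|M. (\<Sum>i\<le>k. coeff (P k) i * z ^ i))"
    by (simp add: poly_altdef degree_P)
  also have "\<dots> = (\<Sum>i\<le>k. coeff (P k) i * (LINT z|M. z ^ i))"
    by (subst Bochner_Integration.integral_sum)
       (auto intro!: integrable_continuous continuous_intros)
  also have "\<dots> = (\<Sum>i<k. coeff (P k) i * (LINT z|M. z ^ i)) + (LINT z|M. z ^ k)"
    by (simp add: lessThan_Suc_atMost[symmetric] coeff_P_top)
  finally show ?thesis by (simp add: eq_neg_iff_add_eq_0 add.commute)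
qed

end

text \<open>Given the mass, orthogonality to \<open>1\<close> determines the moments one after another.\<close>

lemma orth_moments_eq:
  assumes "verblunsky_circle_measure \<alpha> M" "verblunsky_circle_measure \<alpha> M'"
    and "szego_circle_measure.orth \<alpha> M n" "szego_circle_measure.orth \<alpha> M' n"
    and "measure M UNIV = measure M' UNIV" "k \<le> n"
  shows "(LINT z|M. z ^ k) = (LINT z|M'. z ^ k)"
proof -
  interpret M: verblunsky_circle_measure \<alpha> M by fact
  interpret M': verblunsky_circle_measure \<alpha> M' by fact
  show ?thesis using assms(6)
  proof (induction k rule: less_induct)
    case (less k)
    show ?case
    proof (cases "k = 0")
      case True then show ?thesis using assms(5) by simp
    next
      case False
      have "M.orth k" "M'.orth k"
        using M.orth_le[OF assms(3)] M'.orth_le[OF assms(4)] less.prems by auto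
      with False less show ?thesis
        by (simp add: M.orth_moment M'.orth_moment)
    qed
  qed
qed

section \<open>Orthogonal polynomials of a measure\<close>

lemma nontrivial_circle_measure:
  assumes "nontrivial_circle_prob M"
  shows "circle_measure M"
proof -
  interpret prob_space M using assms by (simp add: nontrivial_circle_prob_def)
  show ?thesis
  proof
    show sets: "sets M = sets borel" using assms by (simp add: nontrivial_circle_prob_def)
    have "- sphere 0 1 \<in> null_sets M"
      using assms by (auto simp: nontrivial_circle_prob_def null_sets_def sets)
    then show "AE z in M. norm z = 1"
      by (rule AE_I') auto
  qed
qed

text \<open>The support condition enters here: the zero set of a nonzero polynomial is finite and
  closed, so its complement would be an open null set.\<close>

lemma nontrivial_poly_eq_0:
  assumes "nontrivial_circle_prob M" "(LINT z|M. (norm (poly p z))\<^sup>2) = 0"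
  shows "p = 0"
proof (rule ccontr)
  assume p: "p \<noteq> 0"
  interpret circle_measure M by (rule nontrivial_circle_measure) fact
  have "integrable M (\<lambda>z. (norm (poly p z))\<^sup>2)"
    by (intro integrable_continuous continuous_intros)
  then have "AE z in M. (norm (poly p z))\<^sup>2 = 0"
    using assms(2) by (subst (asm) integral_nonneg_eq_0_iff_AE) auto
  then have ae: "AE z in M. poly p z = 0" by simp
  have "measure_support M \<subseteq> {z. poly p z = 0}"
  proof
    fix z assume z: "z \<in> measure_support M"
    show "z \<in> {z. poly p z = 0}"
    proof (rule ccontr)
      assume nz: "z \<notin> {z. poly p z = 0}"
      let ?U = "- {z. poly p z = 0}"
      have "open ?U"
        using poly_roots_finite[OF p] by (simp add: finite_imp_closed open_Compl)
      with z nz have "emeasure M ?U > 0" by (simp add: measure_support_def)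
      moreover have "emeasure M ?U = 0"
      proof -
        have "emeasure M {z \<in> space M. poly p z \<noteq> 0} = 0"
          by (rule emeasure_eq_0_AE) (use ae in simp)
        moreover have "{z \<in> space M. poly p z \<noteq> 0} = ?U" by auto
        ultimately show ?thesis by simp
      qed
      ultimately show False by simp
    qed
  qed
  then show False
    using assms(1) poly_roots_finite[OF p] finite_subset by (auto simp: nontrivial_circle_prob_def)
qed

lemma poly_eq_sum_le:
  fixes p :: "'a::comm_semiring_1 poly"
  assumes "degree p \<le> n"
  shows "poly p z = (\<Sum>i\<le>n. coeff p i * z ^ i)"
  unfolding poly_altdef
  by (rule sum.mono_neutral_left) (use assms in \<open>auto simp: coeff_eq_0\<close>)

lemma monic_opuc_orth:
  assumes M: "circle_measure M" and "monic_opuc M \<Phi>" "j < n"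
  shows "(LINT z|M. cnj z ^ j * poly (\<Phi> n) z) = 0"
proof -
  interpret circle_measure M by fact
  have deg: "degree (\<Phi> k) = k" "coeff (\<Phi> k) k = 1" for k
    using assms(2) by (auto simp: monic_opuc_def) metis
  have orth: "m \<noteq> n \<Longrightarrow> (LINT z|M. cnj (poly (\<Phi> m) z) * poly (\<Phi> n) z) = 0" for m
    using assms(2) by (auto simp: monic_opuc_def)
  \<comment> \<open>Induction on a strict degree bound d, in a form that makes p = 0 the base case;
    the coefficient at d is removed by subtracting a multiple of \<Phi>_d.\<close>
  have "\<forall>i\<ge>d. coeff p i = 0 \<Longrightarrow> d \<le> n \<Longrightarrow> (LINT z|M. cnj (poly p z) * poly (\<Phi> n) z) = 0" for d p
  proof (induction d arbitrary: p)
    case 0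
    then have "p = 0" by (simp add: poly_eq_iff)
    then show ?case by simp
  next
    case (Suc d)
    define q where "q = p - smult (coeff p d) (\<Phi> d)"
    have "\<forall>i\<ge>d. coeff q i = 0"
    proof (intro allI impI)
      fix i assume "d \<le> i"
      then show "coeff q i = 0"
        using Suc.prems deg[of d] by (cases "i = d") (auto simp: q_def coeff_eq_0)
    qed
    then have q0: "(LINT z|M. cnj (poly q z) * poly (\<Phi> n) z) = 0"
      using Suc.IH Suc.prems by simp
    have "poly p z = poly q z + coeff p d * poly (\<Phi> d) z" for z by (simp add: q_def)
    then have "(\<lambda>z. cnj (poly p z) * poly (\<Phi> n) z)
        = (\<lambda>z. cnj (poly q z) * poly (\<Phi> n) z
            + cnj (coeff p d) * (cnj (poly (\<Phi> d) z) * poly (\<Phi> n) z))"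
      by (simp add: algebra_simps)
    then have "(LINT z|M. cnj (poly p z) * poly (\<Phi> n) z)
        = (LINT z|M. cnj (poly q z) * poly (\<Phi> n) z)
          + (LINT z|M. cnj (coeff p d) * (cnj (poly (\<Phi> d) z) * poly (\<Phi> n) z))"
      by (simp only:) (intro Bochner_Integration.integral_add integrable_continuous continuous_intros)
    then show ?case using q0 orth[of d] Suc.prems by simp
  qed
  from this[of "Suc j" "monom 1 j"] assms(3) show ?thesis
    by (simp add: poly_monom)
qed

text \<open>After expansion of the conjugated factor only its monic top term survives.\<close>

lemma (in szego_circle_measure) orth_norm_square:
  assumes "orth n"
  shows "complex_of_real (LINT z|M. (norm (poly (P n) z))\<^sup>2) = (LINT z|M. cnj z ^ n * poly (P n) z)"
proof -
  have "(LINT z|M. complex_of_real ((norm (poly (P n) z))\<^sup>2))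
      = (LINT z|M. (\<Sum>i\<le>n. cnj (coeff (P n) i) * (cnj z ^ i * poly (P n) z)))"
    unfolding complex_norm_square
    by (simp add: poly_altdef[of "P n"] degree_P sum_distrib_right sum_distrib_left mult_ac)
  also have "\<dots> = (\<Sum>i\<le>n. cnj (coeff (P n) i) * (LINT z|M. cnj z ^ i * poly (P n) z))"
    by (subst Bochner_Integration.integral_sum)
       (auto intro!: integrable_continuous continuous_intros)
  also have "\<dots> = (LINT z|M. cnj z ^ n * poly (P n) z)"
    using assms by (simp add: lessThan_Suc_atMost[symmetric] coeff_P_top orth_def)
  finally show ?thesis by (simp only: integral_complex_of_real)
qed

text \<open>The difference q between \<Phi>_{n+1} and one Szego step has degree at most n, is
  orthogonal to z, ..., z^n and vanishes at 0 by the definition of \<alpha>_n. The missing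
  orthogonality to 1 is thus replaced by a zero constant coefficient, so that <q, q> = 0 and q =
  0.\<close>

theorem monic_opuc_szego:
  assumes nt: "nontrivial_circle_prob M" and op: "monic_opuc M \<Phi>" and \<alpha>: "\<alpha> = verblunsky \<Phi>"
  shows "verblunsky_seq \<alpha>" "\<Phi> n = szego_seq.P \<alpha> n" "szego_circle_measure.orth \<alpha> M n"
proof -
  interpret circle_measure M by (rule nontrivial_circle_measure) fact
  interpret szego_circle_measure \<alpha> M by unfold_locales
  note orthM = monic_opuc_orth[OF circle_measure_axioms op]
  have deg: "degree (\<Phi> k) = k" "coeff (\<Phi> k) k = 1" for k
    using op by (auto simp: monic_opuc_def) metis
  have alpha: "poly (\<Phi> (Suc k)) 0 = - cnj (\<alpha> k)" for k
    by (simp add: \<alpha> verblunsky_def)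
  have P: "\<Phi> n = P n" for n
  proof (induction n)
    case 0
    have "\<Phi> 0 = [:coeff (\<Phi> 0) 0:]"
      using deg(1)[of 0] by (metis degree_0_id)
    then show ?case using deg(2)[of 0] by (simp add: one_pCons)
  next
    case (Suc n)
    define q where "q = \<Phi> (Suc n) - P (Suc n)"
    have q: "q = (\<Phi> (Suc n) - smult 1 (pCons 0 (P n))) - smult (- cnj (\<alpha> n)) (Q n)"
      by (simp add: q_def P_Suc)
    have top: "coeff q i = 0" if "i > n" for i
    proof (cases "i = Suc n")
      case True then show ?thesis by (simp add: q_def deg coeff_P_top)
    next
      case False
      with that have "i > Suc n" by simp
      then show ?thesis by (simp add: q_def coeff_eq_0 deg degree_P)
    qed
    have bot: "coeff q 0 = 0"
      using alpha[of n] by (simp add: q_def poly_0_coeff_0[symmetric] poly_P_Suc poly_Q_0)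
    have mono: "(LINT z|M. cnj z ^ i * poly q z) = 0" if i: "1 \<le> i" "i \<le> n" for i
    proof -
      obtain j where j: "i = Suc j" using i by (cases i) auto
      have "(LINT z|M. cnj z ^ i * poly (Q n) z) = 0"
        using integral_star[of i n] i orthM[of "n - i" n] Suc by simp
      moreover have "(LINT z|M. cnj z ^ i * poly (pCons 0 (P n)) z) = 0"
        unfolding j integral_shift using i j orthM[of j n] Suc by simp
      ultimately show ?thesis
        unfolding q integral_poly_diff using orthM[of i "Suc n"] i by simp
    qed
    have "cnj (poly q z) = (\<Sum>i\<le>n. cnj (coeff q i) * cnj z ^ i)" for z
    proof -
      have "degree q \<le> n" using top by (intro degree_le) auto
      then have "poly q z = (\<Sum>i\<le>n. coeff q i * z ^ i)"
        by (rule poly_eq_sum_le)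
      then show ?thesis by simp
    qed
    then have "(LINT z|M. cnj (poly q z) * poly q z)
        = (LINT z|M. (\<Sum>i\<le>n. cnj (coeff q i) * (cnj z ^ i * poly q z)))"
      by (simp add: sum_distrib_right mult.assoc)
    also have "\<dots> = (\<Sum>i\<le>n. cnj (coeff q i) * (LINT z|M. cnj z ^ i * poly q z))"
      by (subst Bochner_Integration.integral_sum)
         (auto intro!: integrable_continuous continuous_intros)
    also have "\<dots> = 0"
    proof (intro sum.neutral ballI)
      fix i assume "i \<in> {..n}"
      then show "cnj (coeff q i) * (LINT z|M. cnj z ^ i * poly q z) = 0"
        using bot mono[of i] by (cases "i = 0") auto
    qed
    finally have "(LINT z|M. complex_of_real ((norm (poly q z))\<^sup>2)) = 0"
      unfolding complex_norm_square by (simp add: mult.commute)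
    then have "(LINT z|M. (norm (poly q z))\<^sup>2) = 0"
      unfolding integral_complex_of_real by simp
    then have "q = 0" by (rule nontrivial_poly_eq_0[OF nt])
    then show ?case by (simp add: q_def)
  qed
  then show "\<Phi> n = P n" .
  have orth: "orth n" for n
    using orthM P by (simp add: orth_def)
  then show "orth n" .
  interpret prob_space M using nt by (simp add: nontrivial_circle_prob_def)
  define L where "L n = (LINT z|M. (norm (poly (P n) z))\<^sup>2)" for n
  have L: "(LINT z|M. cnj z ^ n * poly (P n) z) = of_real (L n)" for n
    unfolding L_def by (rule orth_norm_square[OF orth, symmetric])
  have L_pos: "L n > 0" for n
  proof -
    have "P n \<noteq> 0" using coeff_P_top[of n] by auto
    then have "L n \<noteq> 0" using nontrivial_poly_eq_0[OF nt] unfolding L_def by blast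
    moreover have "L n \<ge> 0" unfolding L_def by simp
    ultimately show ?thesis by simp
  qed
  \<comment> \<open>Squared norms of consecutive polynomials have ratio 1 - |\<alpha>_n|^2, and both
    are positive by nontriviality.\<close>
  show "verblunsky_seq \<alpha>"
  proof
    fix n
    have "complex_of_real (L (Suc n)) = of_real (rho2 n * L n)"
      using orth_Suc_norm[OF orth[of "Suc n"]] unfolding L by simp
    then have "rho2 n * L n = L (Suc n)" by (simp only: of_real_eq_iff)
    then have "rho2 n > 0" using L_pos[of n] L_pos[of "Suc n"] by (metis zero_less_mult_pos2)
    then have "(norm (\<alpha> n))\<^sup>2 < 1" by (simp add: rho2_def)
    then show "norm (\<alpha> n) < 1" by (simp add: abs_square_less_1)
  qed
qed

section \<open>Bernstein--Szego measures\<close>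

definition circle_lebesgue :: "complex measure" where
  "circle_lebesgue = distr angle_measure borel cis"

lemma cis_measurable [measurable]: "cis \<in> borel_measurable borel"
  by (intro borel_measurable_continuous_onI continuous_intros)

lemma sets_circle_lebesgue [simp, measurable_cong]: "sets circle_lebesgue = sets borel"
  and space_circle_lebesgue [simp]: "space circle_lebesgue = UNIV"
  by (simp_all add: circle_lebesgue_def)

lemma circle_measure_circle_lebesgue: "circle_measure circle_lebesgue"
proof -
  interpret prob_space circle_lebesgue
    unfolding circle_lebesgue_def by (rule angle.prob_space_distr) simp
  show ?thesis
  proof
    have "{z. norm z = 1} \<in> sets (borel :: complex measure)" by measurable
    then show "AE z in circle_lebesgue. norm z = 1"
      unfolding circle_lebesgue_def by (subst AE_distr_iff) simp_all
  qed simp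
qed

context verblunsky_seq
begin

text \<open>\<open>norm_prod n\<close> is the squared norm of \<Phi>_n in any probability measure
  with these coefficients; as a product it makes the weight depend on \<alpha>_0, ...,
  \<alpha>_{n-1} alone.\<close>

definition bs_weight :: "nat \<Rightarrow> complex \<Rightarrow> real" where
  "bs_weight n z = norm_prod n / (norm (poly (Q n) z))\<^sup>2"

definition bs :: "nat \<Rightarrow> complex measure" where
  "bs n = density circle_lebesgue (\<lambda>z. ennreal (bs_weight n z))"

lemma poly_measurable [measurable]: "poly (p :: complex poly) \<in> borel_measurable borel"
  by (intro borel_measurable_continuous_onI continuous_intros)

lemma bs_weight_measurable [measurable]: "bs_weight n \<in> borel_measurable borel"
  unfolding bs_weight_def by measurable

lemma bs_weight_pos: "norm z = 1 \<Longrightarrow> bs_weight n z > 0"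
  using norm_prod_pos[of n] Q_nonzero[of z n] by (simp add: bs_weight_def)

lemma bs_weight_nonneg: "bs_weight n z \<ge> 0"
  using norm_prod_pos[of n] by (simp add: bs_weight_def)

lemma bs_weight_continuous: "continuous_on UNIV (\<lambda>\<theta>. bs_weight n (cis \<theta>))"
  unfolding bs_weight_def using Q_nonzero[of "cis _" n] by (auto intro!: continuous_intros)

lemma integral_bs:
  fixes g :: "complex \<Rightarrow> 'a::euclidean_space"
  assumes [measurable]: "g \<in> borel_measurable borel"
  shows "(LINT z|bs n. g z) = (LINT \<theta>|angle_measure. bs_weight n (cis \<theta>) *\<^sub>R g (cis \<theta>))"
  unfolding bs_def
  by (subst integral_density) (auto simp: bs_weight_nonneg circle_lebesgue_def integral_distr)

lemma circle_measure_bs: "circle_measure (bs n)"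
proof -
  interpret L: circle_measure circle_lebesgue by (rule circle_measure_circle_lebesgue)
  have sets: "sets (bs n) = sets borel" by (simp add: bs_def)
  have "emeasure (bs n) (space (bs n)) = (\<integral>\<^sup>+\<theta>. ennreal (bs_weight n (cis \<theta>)) \<partial>angle_measure)"
    by (simp add: bs_def emeasure_density circle_lebesgue_def nn_integral_distr)
  also have "\<dots> < \<infinity>"
    using angle_continuous(1)[OF bs_weight_continuous[of n]]
    by (subst nn_integral_eq_integral) (auto simp: bs_weight_nonneg)
  finally show ?thesis
  proof (intro circle_measure.intro finite_measureI circle_measure_axioms.intro)
    show "AE z in bs n. norm z = 1"
      unfolding bs_def using L.AE_norm by (subst AE_density) (auto elim!: eventually_mono)
  qed (use sets in auto)
qed

text \<open>On the circle the weighted integrand is a constant times z^(n-j) / \<open>Q n\<close>,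
  which is analytic in the disc. The mean value property gives 0, or for j = n the value at 0, where
  \<open>Q n\<close> is 1.\<close>

lemma integral_bs_P:
  assumes "j \<le> n"
  shows "(LINT z|bs n. cnj z ^ j * poly (P n) z) = (if j = n then of_real (norm_prod n) else 0)"
proof -
  have eq: "bs_weight n z *\<^sub>R (cnj z ^ j * poly (P n) z) = of_real (norm_prod n) * (z ^ (n - j) * (1 / poly (Q n) z))"
    if z: "norm z = 1" for z
  proof -
    let ?q = "poly (Q n) z" and ?p = "poly (P n) z"
    have q: "?q \<noteq> 0" using Q_nonzero[of z n] z by simp
    have zz: "z * cnj z = 1"
      using z by (simp add: complex_norm_square[symmetric])
    have qc: "cnj ?q = cnj z ^ n * ?p" by (simp add: Q_circle[OF z])
    have "z ^ n * cnj z ^ n = 1" using zz by (simp flip: power_mult_distrib)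
    then have p: "?p = z ^ n * cnj ?q" by (simp add: qc mult.assoc[symmetric])
    have "cnj z ^ j * z ^ n = (z * cnj z) ^ j * z ^ (n - j)"
      using assms by (simp add: power_mult_distrib mult_ac flip: power_add)
    then have zj: "cnj z ^ j * z ^ n = z ^ (n - j)" by (simp add: zz)
    have "bs_weight n z *\<^sub>R (cnj z ^ j * ?p) = of_real (norm_prod n) / (?q * cnj ?q) * (cnj z ^ j * z ^ n * cnj ?q)"
      unfolding bs_weight_def scaleR_conv_of_real of_real_divide complex_norm_square
      by (subst p) (simp add: mult_ac)
    also have "\<dots> = of_real (norm_prod n) * (z ^ (n - j) * (1 / ?q))"
      unfolding zj using q by (simp add: field_simps)
    finally show ?thesis .
  qed
  have inv: "(\<lambda>z. 1 / poly (Q n) z) \<in> disc_algebra"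
    by (intro disc_algebra_divide disc_algebra_intros Q_nonzero)
  have m: "(\<lambda>z. cnj z ^ j * poly (P n) z) \<in> borel_measurable borel"
    by (intro borel_measurable_continuous_onI continuous_intros)
  have "(LINT z|bs n. cnj z ^ j * poly (P n) z)
      = of_real (norm_prod n) * (LINT \<theta>|angle_measure. cis \<theta> ^ (n - j) * (1 / poly (Q n) (cis \<theta>)))"
    using integral_bs[OF m, of n] by (simp only: eq norm_cis integral_mult_right_zero)
  also have "\<dots> = (if j = n then of_real (norm_prod n) else 0)"
    using mean_value_circle_power[OF inv, of "n - j"] mean_value_circle[OF inv] assms
    by (auto simp: poly_Q_0)
  finally show ?thesis .
qed

lemma verblunsky_circle_measure_bs: "verblunsky_circle_measure \<alpha> (bs n)"
  by (intro verblunsky_circle_measure.intro verblunsky_seq_axioms szego_circle_measure.intro circle_measure_bs)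

lemma orth_bs: "szego_circle_measure.orth \<alpha> (bs n) n"
proof -
  interpret verblunsky_circle_measure \<alpha> "bs n" by (rule verblunsky_circle_measure_bs)
  show ?thesis unfolding orth_def using integral_bs_P[of _ n] by simp
qed

text \<open>The squared norm of \<Phi>_n is computed twice: from the weight as
  \<open>norm_prod n\<close>, and through the recursion as \<open>norm_prod n\<close> times the
  total mass.\<close>

lemma measure_bs: "measure (bs n) UNIV = 1"
proof -
  interpret verblunsky_circle_measure \<alpha> "bs n" by (rule verblunsky_circle_measure_bs)
  have "complex_of_real (norm_prod n) = of_real (norm_prod n * measure (bs n) UNIV)"
    using orth_norm[OF orth_bs] integral_bs_P[of n n] by simp
  then show ?thesis using norm_prod_pos[of n] by (simp only: of_real_eq_iff) simp
qed

end

lemma (in circle_measure) integral_cnj_power: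
  "(LINT z|M. cnj z ^ i * z ^ j) =
     (if i \<le> j then LINT z|M. z ^ (j - i) else cnj (LINT z|M. z ^ (i - j)))"
proof -
  have "cnj z ^ i * z ^ j = (if i \<le> j then z ^ (j - i) else cnj (z ^ (i - j)))" if "norm z = 1" for z
  proof -
    have zz: "z * cnj z = 1"
      using that by (simp add: complex_norm_square[symmetric])
    show ?thesis
    proof (cases "i \<le> j")
      case True
      then have "cnj z ^ i * z ^ j = (z * cnj z) ^ i * z ^ (j - i)"
        by (simp add: power_mult_distrib mult_ac flip: power_add)
      with True zz show ?thesis by simp
    next
      case False
      then have "cnj z ^ i * z ^ j = (z * cnj z) ^ j * cnj z ^ (i - j)"
        by (simp add: power_mult_distrib mult_ac flip: power_add)
      with False zz show ?thesis by simp
    qed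
  qed
  then have "(LINT z|M. cnj z ^ i * z ^ j) = (LINT z|M. (if i \<le> j then z ^ (j - i) else cnj (z ^ (i - j))))"
    by (intro integral_circle_cong) (cases "i \<le> j"; auto intro!: continuous_intros)+
  then show ?thesis by (cases "i \<le> j") (simp_all only: if_True if_False Bochner_Integration.integral_cnj)
qed

text \<open>Only powers of z between -n and n occur in the integrand, and those are the moments
  fixed by orthogonality up to degree n.\<close>

lemma (in verblunsky_circle_measure) integral_bs_eq:
  assumes "orth n" "measure M UNIV = 1" "m \<le> n" "degree p \<le> n"
  shows "(LINT z|bs n. cnj z ^ m * poly p z) = (LINT z|M. cnj z ^ m * poly p z)"
proof -
  have expand: "(LINT z|M'. cnj z ^ m * poly p z) = (\<Sum>i\<le>n. coeff p i * (LINT z|M'. cnj z ^ m * z ^ i))"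
    if "circle_measure M'" for M'
  proof -
    interpret M': circle_measure M' by fact
    have "(LINT z|M'. cnj z ^ m * poly p z) = (LINT z|M'. (\<Sum>i\<le>n. coeff p i * (cnj z ^ m * z ^ i)))"
      using poly_eq_sum_le[OF assms(4)] by (simp add: sum_distrib_left mult_ac)
    also have "\<dots> = (\<Sum>i\<le>n. coeff p i * (LINT z|M'. cnj z ^ m * z ^ i))"
      by (subst Bochner_Integration.integral_sum)
         (auto intro!: M'.integrable_continuous continuous_intros)
    finally show ?thesis .
  qed
  have mom: "(LINT z|bs n. z ^ k) = (LINT z|M. z ^ k)" if "k \<le> n" for k
    using orth_moments_eq[OF verblunsky_circle_measure_bs verblunsky_circle_measure_axioms orth_bs assms(1)]
      that assms(2) measure_bs by simp
  show ?thesis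
    unfolding expand[OF circle_measure_axioms] expand[OF circle_measure_bs]
      circle_measure.integral_cnj_power[OF circle_measure_axioms]
      circle_measure.integral_cnj_power[OF circle_measure_bs]
    using assms(3) by (intro sum.cong) (auto simp: mom)
qed

section \<open>The step-by-step sum rule\<close>

text \<open>For g in the disc algebra this is the j-th Taylor coefficient; as an integral over the
  circle it arises directly from the entropy and obeys shift rules without derivatives.\<close>

definition circle_coeff :: "nat \<Rightarrow> (complex \<Rightarrow> complex) \<Rightarrow> complex" where
  "circle_coeff j g = (LINT \<theta>|angle_measure. cnj (cis \<theta>) ^ j * g (cis \<theta>))"

lemma circle_coeff_cong:
  "(\<And>z. norm z \<le> 1 \<Longrightarrow> f z = g z) \<Longrightarrow> circle_coeff j f = circle_coeff j g"
  by (simp add: circle_coeff_def)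

lemma circle_coeff_integrable:
  "g \<in> disc_algebra \<Longrightarrow> integrable angle_measure (\<lambda>\<theta>. cnj (cis \<theta>) ^ j * g (cis \<theta>))"
  by (intro angle_continuous continuous_intros disc_algebra_cis_continuous)

lemma circle_coeff_add:
  "f \<in> disc_algebra \<Longrightarrow> g \<in> disc_algebra \<Longrightarrow>
    circle_coeff j (\<lambda>z. f z + g z) = circle_coeff j f + circle_coeff j g"
  unfolding circle_coeff_def
  by (subst Bochner_Integration.integral_add[symmetric])
     (auto simp: distrib_left intro!: circle_coeff_integrable simp del: cis_cnj)

lemma circle_coeff_cmult: "circle_coeff j (\<lambda>z. c * g z) = c * circle_coeff j g"
  unfolding circle_coeff_def by (simp add: mult.left_commute[of _ c] del: cis_cnj)

lemma circle_coeff_0: "g \<in> disc_algebra \<Longrightarrow> circle_coeff 0 g = g 0"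
  by (simp add: circle_coeff_def mean_value_circle)

lemma circle_coeff_power:
  assumes "g \<in> disc_algebra"
  shows "circle_coeff j (\<lambda>z. z ^ i * g z) = (if i \<le> j then circle_coeff (j - i) g else 0)"
proof -
  have cc: "cnj (cis \<theta>) * cis \<theta> = 1" for \<theta>
    by (simp add: cis_cnj cis_mult)
  show ?thesis
  proof (cases "i \<le> j")
    case True
    have "cnj (cis \<theta>) ^ j * (cis \<theta> ^ i * x) = (cnj (cis \<theta>) * cis \<theta>) ^ i * (cnj (cis \<theta>) ^ (j - i) * x)" for \<theta> x
      using True by (simp add: power_mult_distrib mult_ac flip: power_add del: cis_cnj)
    then have "cnj (cis \<theta>) ^ j * (cis \<theta> ^ i * x) = cnj (cis \<theta>) ^ (j - i) * x" for \<theta> x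
      by (simp only: cc power_one mult_1)
    with True show ?thesis by (simp only: circle_coeff_def if_True)
  next
    case False
    have "cnj (cis \<theta>) ^ j * (cis \<theta> ^ i * x) = (cnj (cis \<theta>) * cis \<theta>) ^ j * (cis \<theta> ^ (i - j) * x)" for \<theta> x
      using False by (simp add: power_mult_distrib mult_ac flip: power_add del: cis_cnj)
    then have "cnj (cis \<theta>) ^ j * (cis \<theta> ^ i * x) = cis \<theta> ^ (i - j) * x" for \<theta> x
      by (simp only: cc power_one mult_1)
    with False mean_value_circle_power[OF assms, of "i - j"] show ?thesis
      by (simp only: circle_coeff_def if_False)
  qed
qed

lemma circle_coeff_times_z:
  assumes "g \<in> disc_algebra"
  shows "circle_coeff (Suc j) (\<lambda>z. z * g z) = circle_coeff j g"
  using circle_coeff_power[OF assms, of "Suc j" 1] by simp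

lemma circle_coeff_const: "circle_coeff (Suc j) (\<lambda>z. c) = 0"
proof -
  have "circle_coeff (Suc j) (\<lambda>z. c) = c * cnj (LINT \<theta>|angle_measure. cis \<theta> ^ Suc j * 1)"
    unfolding circle_coeff_def Bochner_Integration.integral_cnj[symmetric] by (simp del: cis_cnj)
  then show ?thesis
    using mean_value_circle_power[of "\<lambda>_. 1" "Suc j"] disc_algebra_intros(1)[of 1] by simp
qed

text \<open>On the circle \<open>1 - cos \<theta> = - (1 - z)\<^sup>2 / (2z)\<close>, whose cube is a Laurent polynomial of degree \<open>3\<close>.\<close>

lemma one_minus_cos_cubed:
  "complex_of_real ((1 - cos \<theta>) ^ 3) =
     5/2 - 15/8 * (cis \<theta> + cnj (cis \<theta>)) + 3/4 * (cis \<theta> ^ 2 + cnj (cis \<theta>) ^ 2)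
     - 1/8 * (cis \<theta> ^ 3 + cnj (cis \<theta>) ^ 3)"
proof -
  define z y where "z = cis \<theta>" and "y = cnj (cis \<theta>)"
  have zy: "z * y = 1" by (simp add: z_def y_def cis_cnj cis_mult)
  have "complex_of_real (cos \<theta>) = (z + y) / 2"
    by (simp add: z_def y_def complex_eq_iff)
  then have "complex_of_real ((1 - cos \<theta>) ^ 3) = (1 - (z + y) / 2) ^ 3"
    by (simp only: of_real_power of_real_diff of_real_1)
  also have "\<dots> = 1 - 3/2 * (z + y) + 3/4 * (z^2 + y^2 + 2 * (z * y))
      - 1/8 * (z^3 + y^3 + 3 * (z * y) * (z + y))"
    by (simp add: power2_eq_square power3_eq_cube field_simps)
  also have "\<dots> = 5/2 - 15/8 * (z + y) + 3/4 * (z^2 + y^2) - 1/8 * (z^3 + y^3)"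
    unfolding zy by (simp add: field_simps)
  finally show ?thesis by (simp only: z_def y_def)
qed

text \<open>Positive powers of z have mean zero against an analytic g, so each cosine frequency
  contributes a single Taylor coefficient.\<close>

lemma integral_one_minus_cos_cubed_Re:
  assumes g: "g \<in> disc_algebra"
  shows "(LINT \<theta>|angle_measure. (1 - cos \<theta>) ^ 3 * Re (g (cis \<theta>))) =
    Re (5/2 * g 0 - 15/8 * circle_coeff 1 g + 3/4 * circle_coeff 2 g - 1/8 * circle_coeff 3 g)"
proof -
  have c: "continuous_on UNIV (\<lambda>\<theta>. g (cis \<theta>))"
    by (rule disc_algebra_cis_continuous[OF g])
  have ip: "integrable angle_measure (\<lambda>\<theta>. cis \<theta> ^ j * g (cis \<theta>))" for j
    by (intro angle_continuous continuous_intros c)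
  have im: "integrable angle_measure (\<lambda>\<theta>. cnj (cis \<theta>) ^ j * g (cis \<theta>))" for j
    by (rule circle_coeff_integrable[OF g])
  have z: "(LINT \<theta>|angle_measure. cis \<theta> ^ j * g (cis \<theta>)) = 0" if "j > 0" for j
    by (rule mean_value_circle_power[OF g that])
  have lin: "(LINT \<theta>|angle_measure. 5/2 * a0 \<theta> - 15/8 * (a1 \<theta> + b1 \<theta>) + 3/4 * (a2 \<theta> + b2 \<theta>)
        - 1/8 * (a3 \<theta> + b3 \<theta>))
      = 5/2 * (LINT \<theta>|angle_measure. a0 \<theta>)
        - 15/8 * ((LINT \<theta>|angle_measure. a1 \<theta>) + (LINT \<theta>|angle_measure. b1 \<theta>))
        + 3/4 * ((LINT \<theta>|angle_measure. a2 \<theta>) + (LINT \<theta>|angle_measure. b2 \<theta>))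
        - 1/8 * ((LINT \<theta>|angle_measure. a3 \<theta>) + (LINT \<theta>|angle_measure. b3 \<theta>))"
    if "integrable angle_measure a0" "integrable angle_measure a1" "integrable angle_measure b1"
      "integrable angle_measure a2" "integrable angle_measure b2"
      "integrable angle_measure a3" "integrable angle_measure b3"
    for a0 a1 b1 a2 b2 a3 b3 :: "real \<Rightarrow> complex"
    using that by simp
  have "(LINT \<theta>|angle_measure. (1 - cos \<theta>) ^ 3 * Re (g (cis \<theta>)))
      = (LINT \<theta>|angle_measure. Re (complex_of_real ((1 - cos \<theta>) ^ 3) * g (cis \<theta>)))"
    by (simp only: Re_complex_of_real Im_complex_of_real times_complex.sel) simp
  also have "\<dots> = Re (LINT \<theta>|angle_measure. complex_of_real ((1 - cos \<theta>) ^ 3) * g (cis \<theta>))"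
    by (intro integral_Re angle_continuous continuous_intros c)
  also have "(LINT \<theta>|angle_measure. complex_of_real ((1 - cos \<theta>) ^ 3) * g (cis \<theta>))
      = (LINT \<theta>|angle_measure. 5/2 * (cnj (cis \<theta>) ^ 0 * g (cis \<theta>))
          - 15/8 * (cis \<theta> ^ 1 * g (cis \<theta>) + cnj (cis \<theta>) ^ 1 * g (cis \<theta>))
          + 3/4 * (cis \<theta> ^ 2 * g (cis \<theta>) + cnj (cis \<theta>) ^ 2 * g (cis \<theta>))
          - 1/8 * (cis \<theta> ^ 3 * g (cis \<theta>) + cnj (cis \<theta>) ^ 3 * g (cis \<theta>)))"
    unfolding one_minus_cos_cubed by (intro Bochner_Integration.integral_cong refl) (simp add: algebra_simps del: cis_cnj)
  also have "\<dots> = 5/2 * circle_coeff 0 g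
      - 15/8 * ((LINT \<theta>|angle_measure. cis \<theta> ^ 1 * g (cis \<theta>)) + circle_coeff 1 g)
      + 3/4 * ((LINT \<theta>|angle_measure. cis \<theta> ^ 2 * g (cis \<theta>)) + circle_coeff 2 g)
      - 1/8 * ((LINT \<theta>|angle_measure. cis \<theta> ^ 3 * g (cis \<theta>)) + circle_coeff 3 g)"
    unfolding circle_coeff_def by (rule lin) (rule ip im)+
  finally show ?thesis
    using z[of 1] z[of 2] z[of 3] by (simp add: circle_coeff_0[OF g] del: power_one_right)
qed

text \<open>For v = u(z) with u(0) = 0 the remainder is divisible by z^4 and leaves the Taylor
  coefficients up to order 3 untouched. Analyticity of \<open>H\<close> keeps the cofactor of z^4 in
  the disc algebra.\<close>

lemma Ln_one_minus_expansion:
  obtains H :: "complex \<Rightarrow> complex" where "H holomorphic_on ball 0 1"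
    "\<And>v. norm v < 1 \<Longrightarrow> Ln (1 - v) = - (v + v^2/2 + v^3/3) + v^4 * H v"
proof
  define H :: "complex \<Rightarrow> complex" where "H v = (\<Sum>k. - 1 / of_nat (k + 4) * v ^ k)" for v
  \<comment> \<open>At index 0 the division by zero yields 0, so the series effectively starts at n
    = 1.\<close>
  have sums: "(\<lambda>n. - 1 / of_nat n * v ^ n) sums Ln (1 - v)" if "norm v < 1" for v :: complex
  proof -
    have "(\<lambda>n. (-1)^Suc n / of_nat n * (-v)^n) sums ln (1 + (-v))"
      by (rule Ln_series) (use that in simp)
    moreover have "(-1)^Suc n / of_nat n * (-v)^n = - 1 / of_nat n * v ^ n" for n
    proof -
      have "(-1)^Suc n * (-v)^n = - (v ^ n)" by (cases "even n") auto
      then show ?thesis by (simp only: times_divide_eq_left) simp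
    qed
    ultimately show ?thesis by (simp only: add_uminus_conv_diff)
  qed
  have sums4: "(\<lambda>k. v ^ 4 * (- 1 / of_nat (k + 4) * v ^ k)) sums (Ln (1 - v) + (v + v^2/2 + v^3/3))"
    if "norm v < 1" for v :: complex
  proof -
    have "(\<lambda>k. - 1 / of_nat (k + 4) * v ^ (k + 4)) sums
        (Ln (1 - v) - (\<Sum>n<4. - 1 / of_nat n * v ^ n))"
      by (rule sums_split_initial_segment[OF sums[OF that]])
    moreover have "Ln (1 - v) - (\<Sum>n<4. - 1 / of_nat n * v ^ n) = Ln (1 - v) + (v + v^2/2 + v^3/3)"
      by (simp add: eval_nat_numeral)
    ultimately show ?thesis by (simp only: power_add mult_ac)
  qed
  have summ: "summable (\<lambda>k. - 1 / of_nat (k + 4) * v ^ k)" if "norm v < 1" for v :: complex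
  proof (rule summable_comparison_test')
    show "summable (\<lambda>k. norm v ^ k)" using that by (intro summable_geometric) simp
    show "norm (- 1 / of_nat (k + 4) * v ^ k) \<le> norm v ^ k" if "k \<ge> 0" for k
    proof -
      have "norm (- 1 / complex_of_nat (k + 4)) = 1 / real (k + 4)"
        by (metis norm_divide norm_minus_cancel norm_of_nat norm_one)
      also have "\<dots> \<le> 1" by simp
      finally have "norm (- 1 / complex_of_nat (k + 4)) \<le> 1" .
      from mult_right_mono[OF this, of "norm v ^ k"] show ?thesis
        by (simp only: norm_mult norm_power) simp
    qed
  qed
  have eq: "v ^ 4 * H v = Ln (1 - v) + (v + v^2/2 + v^3/3)" if "norm v < 1" for v
    using sums_unique2[OF sums_mult[OF summable_sums[OF summ[OF that]]] sums4[OF that]]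
    by (simp add: H_def)
  show "Ln (1 - v) = - (v + v^2/2 + v^3/3) + v^4 * H v" if "norm v < 1" for v
    using eq[OF that] by simp
  show "H holomorphic_on ball 0 1"
  proof (rule power_series_holomorphic)
    show "(\<lambda>k. - 1 / of_nat (k + 4) * (w - 0) ^ k) sums H w" if "w \<in> ball 0 1" for w
      using summable_sums[OF summ[of w]] that by (simp add: H_def)
  qed
qed

text \<open>
  Here \<open>u1, u2, u3\<close> are the Taylor coefficients at \<open>0\<close> of \<open>u = \<alpha>\<^sub>n z b\<^sub>n\<close>, the polynomials in them are those of
  \<open>- log (1 - u)\<close>, and \<open>-15/8, 3/4, -1/8\<close> are the Fourier coefficients of \<open>(1 - cos \<theta>)\<^sup>3\<close>.
\<close>

definition entropy_increment :: "complex \<Rightarrow> complex \<Rightarrow> complex \<Rightarrow> complex \<Rightarrow> real" where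
  "entropy_increment a0 a1 a2 a3 =
    (let r1 = 1 - a1 * cnj a1; r2 = 1 - a2 * cnj a2;
         u1 = - (a0 * cnj a1); u2 = - (a0 * r1 * cnj a2);
         u3 = a0 * (r1 * a1 * (cnj a2)^2 - r1 * r2 * cnj a3)
     in 2 * Re (- 15/8 * u1 + 3/4 * (u2 + u1^2 / 2) - 1/8 * (u3 + u1 * u2 + u1^3 / 3)))"

section \<open>Taylor coefficients of the Schur functions b_n\<close>

context verblunsky_seq
begin

definition schur_fun :: "nat \<Rightarrow> complex \<Rightarrow> complex" where
  "schur_fun n z = poly (P n) z / poly (Q n) z"

text \<open>Since b_{n+1} = (z b_n - cnj \<alpha>_n) / (1 - \<alpha>_n z b_n), this is (b_{n+1} -
  b_{n+1}(0)) / z; the closed form avoids the removable singularity at 0.\<close>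

definition schur_quot :: "nat \<Rightarrow> complex \<Rightarrow> complex" where
  "schur_quot n z = of_real (rho2 n) * schur_fun n z / (1 - \<alpha> n * (z * schur_fun n z))"

text \<open>The quotient of \<open>schur_quot n\<close> - \<open>rho2 n\<close> b_n by z, again in a
  form regular at 0, where its value enters the second Taylor coefficient of b_{n+1}.\<close>

definition schur_rem :: "nat \<Rightarrow> complex \<Rightarrow> complex" where
  "schur_rem n z = of_real (rho2 n) * \<alpha> n * (schur_fun n z)^2 / (1 - \<alpha> n * (z * schur_fun n z))"

lemma schur_fun_disc: "schur_fun n \<in> disc_algebra"
  unfolding schur_fun_def by (intro disc_algebra_divide disc_algebra_intros Q_nonzero)

lemma norm_schur_fun_le: "norm z \<le> 1 \<Longrightarrow> norm (schur_fun n z) \<le> 1"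
  using Q_dominates[of z n] by (simp add: schur_fun_def norm_divide divide_le_eq)

lemma norm_azschur_le:
  assumes "norm z \<le> 1"
  shows "norm (\<alpha> n * (z * schur_fun n z)) \<le> norm (\<alpha> n)"
proof -
  have "norm z * norm (schur_fun n z) \<le> 1"
    using assms norm_schur_fun_le[OF assms, of n] by (simp add: mult_le_one)
  then show ?thesis
    using mult_left_mono[of _ 1 "norm (\<alpha> n)"] by (simp add: norm_mult)
qed

lemma azschur_ne: "norm z \<le> 1 \<Longrightarrow> 1 - \<alpha> n * (z * schur_fun n z) \<noteq> 0"
  using norm_azschur_le[of z n] norm_alpha[of n] by auto

lemma schur_quot_disc: "schur_quot n \<in> disc_algebra"
  unfolding schur_quot_def
  by (intro disc_algebra_divide disc_algebra_intros schur_fun_disc azschur_ne)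

lemma schur_rem_disc: "schur_rem n \<in> disc_algebra"
  unfolding schur_rem_def
  by (intro disc_algebra_divide disc_algebra_intros schur_fun_disc azschur_ne)

lemma of_real_rho2': "complex_of_real (rho2 n) = 1 - \<alpha> n * cnj (\<alpha> n)"
  unfolding rho2_def of_real_diff complex_norm_square by simp

lemma Q_Suc_schur: "norm z \<le> 1 \<Longrightarrow> poly (Q (Suc n)) z = poly (Q n) z * (1 - \<alpha> n * (z * schur_fun n z))"
  using Q_nonzero[of z n] by (simp add: poly_Q_Suc schur_fun_def field_simps)

lemma schur_fun_Suc:
  assumes "norm z \<le> 1"
  shows "schur_fun (Suc n) z = - cnj (\<alpha> n) + z * schur_quot n z"
proof -
  let ?q = "poly (Q n) z" and ?D = "1 - \<alpha> n * (z * schur_fun n z)"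
  have q: "?q \<noteq> 0" and D: "?D \<noteq> 0" using Q_nonzero azschur_ne assms by auto
  have p: "poly (P n) z = ?q * schur_fun n z" using q by (simp add: schur_fun_def)
  have "schur_fun (Suc n) z = (?q * (z * schur_fun n z - cnj (\<alpha> n))) / (?q * ?D)"
    unfolding schur_fun_def[of "Suc n"] Q_Suc_schur[OF assms] poly_P_Suc p by (simp add: algebra_simps)
  also have "\<dots> = (z * schur_fun n z - cnj (\<alpha> n)) / ?D" using q by (rule mult_divide_mult_cancel_left)
  also have "\<dots> = (- cnj (\<alpha> n) * ?D + z * (of_real (rho2 n) * schur_fun n z)) / ?D"
    unfolding of_real_rho2' by (simp add: algebra_simps)
  also have "\<dots> = - cnj (\<alpha> n) + z * schur_quot n z"
    unfolding schur_quot_def add_divide_distrib using D by simp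
  finally show ?thesis .
qed

lemma schur_quot_eq:
  assumes "norm z \<le> 1"
  shows "schur_quot n z = of_real (rho2 n) * schur_fun n z + z * schur_rem n z"
proof -
  let ?D = "1 - \<alpha> n * (z * schur_fun n z)"
  have D: "?D \<noteq> 0" using azschur_ne assms by auto
  have "schur_quot n z = (of_real (rho2 n) * schur_fun n z * ?D + z * (of_real (rho2 n) * \<alpha> n * (schur_fun n z)^2)) / ?D"
    unfolding schur_quot_def by (simp add: algebra_simps power2_eq_square)
  also have "\<dots> = of_real (rho2 n) * schur_fun n z + z * schur_rem n z"
    unfolding schur_rem_def add_divide_distrib using D by simp
  finally show ?thesis .
qed

lemma schur_fun_Suc_0: "schur_fun (Suc n) 0 = - cnj (\<alpha> n)"
  using schur_fun_Suc[of 0 n] by simp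

text \<open>Removing the constant term and dividing by z lowers the order of the coefficient and the
  index of b together. This is why the j-th coefficient of b_n reaches back only to
  \<alpha>_{n-1-j}.\<close>

lemma circle_coeff_schur_Suc: "circle_coeff (Suc j) (schur_fun (Suc n)) = circle_coeff j (schur_quot n)"
proof -
  have "circle_coeff (Suc j) (schur_fun (Suc n)) = circle_coeff (Suc j) (\<lambda>z. - cnj (\<alpha> n) + z * schur_quot n z)"
    by (rule circle_coeff_cong) (rule schur_fun_Suc)
  also have "\<dots> = circle_coeff (Suc j) (\<lambda>z. - cnj (\<alpha> n)) + circle_coeff (Suc j) (\<lambda>z. z * schur_quot n z)"
    by (rule circle_coeff_add) (intro disc_algebra_intros schur_quot_disc)+
  finally show ?thesis
    by (simp only: circle_coeff_const circle_coeff_times_z[OF schur_quot_disc] add_0)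
qed

lemma circle_coeff_1_schur:
  "circle_coeff 1 (schur_fun (Suc (Suc n))) = - of_real (rho2 (Suc n)) * cnj (\<alpha> n)"
  using circle_coeff_schur_Suc[of 0 "Suc n"] schur_quot_eq[of 0 "Suc n"]
  by (simp add: circle_coeff_0 schur_quot_disc schur_fun_Suc_0)

lemma circle_coeff_2_schur:
  "circle_coeff 2 (schur_fun (Suc (Suc (Suc n)))) =
     of_real (rho2 (Suc (Suc n))) * (\<alpha> (Suc (Suc n)) * (cnj (\<alpha> (Suc n)))^2
        - of_real (rho2 (Suc n)) * cnj (\<alpha> n))"
proof -
  have "circle_coeff 2 (schur_fun (Suc (Suc (Suc n)))) = circle_coeff (Suc 0) (schur_quot (Suc (Suc n)))"
    using circle_coeff_schur_Suc[of 1] by (simp add: numeral_2_eq_2)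
  also have "\<dots> = circle_coeff (Suc 0) (\<lambda>z. of_real (rho2 (Suc (Suc n))) * schur_fun (Suc (Suc n)) z + z * schur_rem (Suc (Suc n)) z)"
    by (rule circle_coeff_cong) (rule schur_quot_eq)
  also have "\<dots> = of_real (rho2 (Suc (Suc n))) * circle_coeff 1 (schur_fun (Suc (Suc n))) + schur_rem (Suc (Suc n)) 0"
    by (simp add: circle_coeff_add disc_algebra_intros schur_fun_disc schur_rem_disc circle_coeff_cmult
        circle_coeff_times_z circle_coeff_0)
  finally show ?thesis
    unfolding circle_coeff_1_schur by (simp add: schur_rem_def schur_fun_Suc_0 algebra_simps)
qed

lemma circle_coeff_1_schur_square:
  "circle_coeff 1 (\<lambda>z. (schur_fun (Suc (Suc n)) z)^2) = 2 * of_real (rho2 (Suc n)) * cnj (\<alpha> (Suc n)) * cnj (\<alpha> n)"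
proof -
  let ?a = "\<alpha> (Suc n)"
  have "circle_coeff 1 (\<lambda>z. (schur_fun (Suc (Suc n)) z)^2)
      = circle_coeff (Suc 0) (\<lambda>z. (cnj ?a)^2 + z * (- 2 * cnj ?a * schur_quot (Suc n) z + z * (schur_quot (Suc n) z)^2))"
    unfolding One_nat_def by (rule circle_coeff_cong) (simp add: schur_fun_Suc power2_eq_square algebra_simps)
  also have "\<dots> = - 2 * cnj ?a * schur_quot (Suc n) 0"
    by (simp add: circle_coeff_add disc_algebra_intros schur_quot_disc circle_coeff_const circle_coeff_times_z circle_coeff_0)
  finally show ?thesis
    using schur_quot_eq[of 0 "Suc n"] by (simp add: schur_fun_Suc_0)
qed

section \<open>The entropy increment per step\<close>

definition bs_entropy :: "nat \<Rightarrow> real" where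
  "bs_entropy n = (LINT \<theta>|angle_measure. (1 - cos \<theta>) ^ 3 * ln (bs_weight n (cis \<theta>)))"

lemma ln_bs_weight_continuous: "continuous_on UNIV (\<lambda>\<theta>. ln (bs_weight n (cis \<theta>)))"
proof (intro continuous_intros bs_weight_continuous ballI)
  show "bs_weight n (cis \<theta>) \<noteq> 0" for \<theta>
    using bs_weight_pos[of "cis \<theta>" n] by simp
qed

lemma integral_one_minus_cos_cubed: "(LINT \<theta>|angle_measure. (1 - cos \<theta>) ^ 3) = 5/2"
  using integral_one_minus_cos_cubed_Re[of "\<lambda>_. 1"] circle_coeff_const[of _ 1]
  by (simp add: disc_algebra_intros numeral_2_eq_2 numeral_3_eq_3)

lemma ln_bs_weight_Suc:
  assumes "norm z = 1"
  shows "ln (bs_weight (Suc n) z) =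
    ln (bs_weight n z) + ln (rho2 n) - 2 * Re (Ln (1 - \<alpha> n * (z * schur_fun n z)))"
proof -
  let ?D = "1 - \<alpha> n * (z * schur_fun n z)"
  have D: "?D \<noteq> 0" using azschur_ne assms by auto
  have "bs_weight (Suc n) z = bs_weight n z * rho2 n / (norm ?D)^2"
    using assms by (simp add: bs_weight_def norm_prod_def Q_Suc_schur norm_mult power_mult_distrib)
  then show ?thesis
    using bs_weight_pos[OF assms, of n] rho2_pos[of n] D
    by (simp add: ln_div ln_mult ln_realpow Re_Ln)
qed

text \<open>Up to order 3 the expansion of log(1 - \<alpha>_m z b_m) involves b_m up to order 2,
  that is \<alpha>_{m-1}, \<alpha>_{m-2}, \<alpha>_{m-3}. Hence the start at m = 3: below it these
  Taylor coefficients also see the initial value b_0 = 1.\<close>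

lemma bs_entropy_Suc:
  "bs_entropy (Suc (Suc (Suc (Suc n)))) = bs_entropy (Suc (Suc (Suc n))) + 5/2 * ln (rho2 (Suc (Suc (Suc n))))
     + entropy_increment (\<alpha> (Suc (Suc (Suc n)))) (\<alpha> (Suc (Suc n))) (\<alpha> (Suc n)) (\<alpha> n)"
proof -
  define m where "m = Suc (Suc (Suc n))"
  define a where "a = \<alpha> m"
  define u where "u z = a * (z * schur_fun m z)" for z
  define G where "G z = Ln (1 - u z)" for z
  obtain H where H: "H holomorphic_on ball 0 1"
    and LnH: "\<And>v. norm v < 1 \<Longrightarrow> Ln (1 - v) = - (v + v^2/2 + v^3/3) + v^4 * H v"
    using Ln_one_minus_expansion by blast
  have u_lt: "norm (u z) < 1" if "norm z \<le> 1" for z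
    using norm_azschur_le[OF that, of m] norm_alpha[of m] by (simp add: u_def a_def)
  have u_disc: "u \<in> disc_algebra"
    unfolding u_def by (intro disc_algebra_intros schur_fun_disc)
  \<comment> \<open>\<open>H\<close> is analytic only in the open disc, but |u| < 1 also on the
    boundary circle, so the composition is continuous up to it.\<close>
  have Hu: "(\<lambda>z. H (u z)) \<in> disc_algebra"
    unfolding disc_algebra_def
  proof safe
    show "continuous_on (cball 0 1) (\<lambda>z. H (u z))"
      by (rule continuous_on_compose2[OF holomorphic_on_imp_continuous_on[OF H]])
         (use u_disc u_lt in \<open>auto simp: disc_algebra_def\<close>)
    show "(\<lambda>z. H (u z)) holomorphic_on ball 0 1"
    proof (rule holomorphic_on_compose_gen[OF _ H, unfolded o_def])
      show "u holomorphic_on ball 0 1" using u_disc by (simp add: disc_algebra_def)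
      show "u ` ball 0 1 \<subseteq> ball 0 1" using u_lt by auto
    qed
  qed
  have G_eq: "G z = - a * (z * schur_fun m z) + z ^ 2 * (- (a^2/2) * (schur_fun m z)^2)
      + z^3 * (- (a^3/3) * (schur_fun m z)^3) + z^4 * ((a * schur_fun m z)^4 * H (u z))" if "norm z \<le> 1" for z
    unfolding G_def LnH[OF u_lt[OF that]] by (simp add: u_def power_mult_distrib mult_ac)
  have bk: "(\<lambda>z. schur_fun m z ^ k) \<in> disc_algebra" for k by (intro disc_algebra_intros schur_fun_disc)
  have B4: "(\<lambda>z. (a * schur_fun m z)^4 * H (u z)) \<in> disc_algebra"
    by (intro disc_algebra_intros schur_fun_disc Hu)
  have coeff: "circle_coeff k G = - a * circle_coeff k (\<lambda>z. z ^ 1 * schur_fun m z)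
      + circle_coeff k (\<lambda>z. z ^ 2 * (- (a^2/2) * (schur_fun m z)^2))
      + circle_coeff k (\<lambda>z. z^3 * (- (a^3/3) * (schur_fun m z)^3))
      + circle_coeff k (\<lambda>z. z^4 * ((a * schur_fun m z)^4 * H (u z)))" for k
  proof -
    have "circle_coeff k G = circle_coeff k (\<lambda>z. - a * (z ^ 1 * schur_fun m z) + z ^ 2 * (- (a^2/2) * (schur_fun m z)^2)
      + z^3 * (- (a^3/3) * (schur_fun m z)^3) + z^4 * ((a * schur_fun m z)^4 * H (u z)))"
      by (rule circle_coeff_cong) (simp only: G_eq power_one_right)
    also have "\<dots> = circle_coeff k (\<lambda>z. - a * (z ^ 1 * schur_fun m z))
      + circle_coeff k (\<lambda>z. z ^ 2 * (- (a^2/2) * (schur_fun m z)^2))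
      + circle_coeff k (\<lambda>z. z^3 * (- (a^3/3) * (schur_fun m z)^3))
      + circle_coeff k (\<lambda>z. z^4 * ((a * schur_fun m z)^4 * H (u z)))"
      by (subst circle_coeff_add | intro disc_algebra_intros schur_fun_disc Hu)+ (rule refl)
    finally show ?thesis by (simp only: circle_coeff_cmult)
  qed
  have p1: "circle_coeff k (\<lambda>z. z ^ 1 * schur_fun m z) = (if 1 \<le> k then circle_coeff (k - 1) (schur_fun m) else 0)" for k
    by (rule circle_coeff_power) (rule schur_fun_disc)
  have p2: "circle_coeff k (\<lambda>z. z ^ 2 * (- (a^2/2) * (schur_fun m z)^2)) = (if 2 \<le> k then - (a^2/2) * circle_coeff (k - 2) (\<lambda>z. (schur_fun m z)^2) else 0)" for k
    by (subst circle_coeff_power) (simp_all only: circle_coeff_cmult disc_algebra_intros bk)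
  have p3: "circle_coeff k (\<lambda>z. z ^ 3 * (- (a^3/3) * (schur_fun m z)^3)) = (if 3 \<le> k then - (a^3/3) * circle_coeff (k - 3) (\<lambda>z. (schur_fun m z)^3) else 0)" for k
    by (subst circle_coeff_power) (simp_all only: circle_coeff_cmult disc_algebra_intros bk)
  have p4: "circle_coeff k (\<lambda>z. z ^ 4 * ((a * schur_fun m z)^4 * H (u z))) = 0" if "k < 4" for k
    using that by (subst circle_coeff_power[OF B4]) simp
  have b0: "schur_fun m 0 = - cnj (\<alpha> (Suc (Suc n)))" by (simp add: m_def schur_fun_Suc_0)
  have c0: "circle_coeff 0 (\<lambda>z. schur_fun m z ^ k) = (schur_fun m 0) ^ k" for k
    by (rule circle_coeff_0[OF bk])
  have c0': "circle_coeff 0 (schur_fun m) = schur_fun m 0" by (rule circle_coeff_0[OF schur_fun_disc])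
  have G1: "circle_coeff 1 G = - a * schur_fun m 0"
    unfolding coeff p1 p2 p3 using p4[of 1] by (simp add: c0')
  have G2: "circle_coeff 2 G = - a * circle_coeff 1 (schur_fun m) - a^2/2 * (schur_fun m 0)^2"
    unfolding coeff p1 p2 p3 using p4[of 2] by (simp add: c0)
  have G3: "circle_coeff 3 G = - a * circle_coeff 2 (schur_fun m) - a^2/2 * circle_coeff 1 (\<lambda>z. (schur_fun m z)^2) - a^3/3 * (schur_fun m 0)^3"
    unfolding coeff p1 p2 p3 using p4[of 3] by (simp add: c0)
  have G0: "G 0 = 0" by (simp add: G_def u_def)
  have G_disc: "G \<in> disc_algebra"
    unfolding disc_algebra_def
  proof safe
    \<comment> \<open>1 - u stays in the open right half-plane, away from the cut of the principal
      logarithm.\<close>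
    have nr: "1 - u z \<notin> \<real>\<^sub>\<le>\<^sub>0" if "norm z \<le> 1" for z
      using u_lt[OF that] abs_Re_le_cmod[of "u z"] by (auto simp: complex_nonpos_Reals_iff)
    show "continuous_on (cball 0 1) G"
      unfolding G_def using u_disc nr by (auto intro!: continuous_intros simp: disc_algebra_def)
    show "G holomorphic_on ball 0 1"
      unfolding G_def using u_disc nr by (auto intro!: holomorphic_intros simp: disc_algebra_def)
  qed
  have cw: "continuous_on UNIV (\<lambda>\<theta>. ln (bs_weight m (cis \<theta>)))"
    by (rule ln_bs_weight_continuous)
  have cG: "continuous_on UNIV (\<lambda>\<theta>. G (cis \<theta>))"
    by (rule disc_algebra_cis_continuous[OF G_disc])
  have "bs_entropy (Suc m) = (LINT \<theta>|angle_measure. (1 - cos \<theta>) ^ 3 * ln (bs_weight m (cis \<theta>))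
      + ln (rho2 m) * (1 - cos \<theta>) ^ 3 - 2 * ((1 - cos \<theta>) ^ 3 * Re (G (cis \<theta>))))"
    unfolding bs_entropy_def
    by (intro Bochner_Integration.integral_cong refl)
       (simp add: ln_bs_weight_Suc G_def u_def a_def algebra_simps)
  also have "\<dots> = (LINT \<theta>|angle_measure. (1 - cos \<theta>) ^ 3 * ln (bs_weight m (cis \<theta>))
      + ln (rho2 m) * (1 - cos \<theta>) ^ 3) - (LINT \<theta>|angle_measure. 2 * ((1 - cos \<theta>) ^ 3 * Re (G (cis \<theta>))))"
    by (intro Bochner_Integration.integral_diff angle_continuous continuous_intros cw cG)
  also have "(LINT \<theta>|angle_measure. (1 - cos \<theta>) ^ 3 * ln (bs_weight m (cis \<theta>))
      + ln (rho2 m) * (1 - cos \<theta>) ^ 3) = bs_entropy m + (LINT \<theta>|angle_measure. ln (rho2 m) * (1 - cos \<theta>) ^ 3)"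
    unfolding bs_entropy_def by (intro Bochner_Integration.integral_add angle_continuous continuous_intros cw)
  finally have "bs_entropy (Suc m) = bs_entropy m + 5/2 * ln (rho2 m)
      - 2 * Re (- 15/8 * circle_coeff 1 G + 3/4 * circle_coeff 2 G - 1/8 * circle_coeff 3 G)"
    using integral_one_minus_cos_cubed integral_one_minus_cos_cubed_Re[OF G_disc]
    by (simp add: G0)
  moreover have "- 2 * Re (- 15/8 * circle_coeff 1 G + 3/4 * circle_coeff 2 G - 1/8 * circle_coeff 3 G)
      = entropy_increment (\<alpha> m) (\<alpha> (Suc (Suc n))) (\<alpha> (Suc n)) (\<alpha> n)"
  proof -
    define r1 r2 where "r1 = complex_of_real (rho2 (Suc (Suc n)))" and "r2 = complex_of_real (rho2 (Suc n))"
    define a1 a2 a3 where "a1 = \<alpha> (Suc (Suc n))" and "a2 = \<alpha> (Suc n)" and "a3 = \<alpha> n"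
    have r: "1 - a1 * cnj a1 = r1" "1 - a2 * cnj a2 = r2"
      by (simp_all add: r1_def r2_def a1_def a2_def of_real_rho2')
    have e: "circle_coeff 1 (schur_fun m) = - r1 * cnj a2" "circle_coeff 2 (schur_fun m) = r1 * (a1 * (cnj a2)^2 - r2 * cnj a3)"
      "circle_coeff 1 (\<lambda>z. (schur_fun m z)^2) = 2 * r1 * cnj a1 * cnj a2" "schur_fun m 0 = - cnj a1"
      unfolding m_def r1_def r2_def a1_def a2_def a3_def
      by (simp_all add: circle_coeff_1_schur circle_coeff_2_schur circle_coeff_1_schur_square schur_fun_Suc_0 del: One_nat_def)
    have "- 15/8 * circle_coeff 1 G + 3/4 * circle_coeff 2 G - 1/8 * circle_coeff 3 G
        = - (- 15/8 * - (a * cnj a1) + 3/4 * (- (a * r1 * cnj a2) + (- (a * cnj a1))\<^sup>2 / 2)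
            - 1/8 * (a * (r1 * a1 * (cnj a2)\<^sup>2 - r1 * r2 * cnj a3)
                + - (a * cnj a1) * - (a * r1 * cnj a2) + (- (a * cnj a1)) ^ 3 / 3))"
      unfolding G1 G2 G3 e by (simp add: field_simps power2_eq_square power3_eq_cube)
    then show ?thesis
      by (simp only: entropy_increment_def Let_def a_def[symmetric]
        a1_def[symmetric] a2_def[symmetric] a3_def[symmetric] r uminus_complex.sel minus_mult_minus)
  qed
  ultimately show ?thesis by (simp add: m_def)
qed

end

section \<open>Coefficients of bounded variation\<close>

text \<open>On the diagonal r1 = r2 = 1 - X with X = |a|^2, and every monomial pairs each a with a
  conjugate, so the whole expression is a real polynomial in X.\<close>

lemma entropy_increment_constant:
  "entropy_increment a a a a = 5/2 * ((norm a)^2 + (norm a)^4 / 2 + (norm a)^6 / 3)"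
proof -
  define x where "x = (norm a)\<^sup>2"
  define X where "X = complex_of_real x"
  have X: "a * cnj a = X" by (simp only: X_def x_def complex_norm_square)
  have 1: "- (a * (1 - X) * cnj a) = - X * (1 - X)" by (simp add: X[symmetric])
  have 2: "a * ((1 - X) * a * (cnj a)^2 - (1 - X) * (1 - X) * cnj a) = (1 - X) * X^2 - (1 - X)^2 * X"
    by (simp add: X[symmetric] power2_eq_square algebra_simps)
  have "entropy_increment a a a a =
      2 * Re (complex_of_real (5/4 * (x + x^2/2 + x^3/3)))"
    unfolding entropy_increment_def Let_def X 1 2
    unfolding X_def by (simp add: field_simps power2_eq_square power3_eq_cube)
  also have "\<dots> = 5/2 * (x + x^2/2 + x^3/3)" by simp
  finally show ?thesis by (simp add: x_def flip: power_mult)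
qed

text \<open>A polynomial is Lipschitz on the closed unit polydisc; the work lies in an explicit
  constant. Comparing all arguments with the newest coefficient a0 leaves consecutive differences,
  which are summable under bounded variation.\<close>

lemma entropy_increment_lipschitz:
  assumes n: "norm a0 \<le> 1" "norm a1 \<le> 1" "norm a2 \<le> 1" "norm a3 \<le> 1"
  shows "\<bar>entropy_increment a0 a1 a2 a3 - entropy_increment a0 a0 a0 a0\<bar>
     \<le> 22 * (norm (a0 - a1) + norm (a1 - a2) + norm (a2 - a3))"
proof -
  define e where "e = norm (a0 - a1) + norm (a1 - a2) + norm (a2 - a3)"
  \<comment> \<open>In the unit disc Lipschitz constants add under products, so K counts the factors
    of a monomial, with 1 - x * cnj x counted as two and the constant -1 as none.\<close>
  define near :: "real \<Rightarrow> complex \<Rightarrow> complex \<Rightarrow> bool" where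
    "near K x y \<longleftrightarrow> norm x \<le> 1 \<and> norm y \<le> 1 \<and> norm (x - y) \<le> K * e" for K x y
  have e0: "e \<ge> 0" by (simp add: e_def)
  have d: "norm (a1 - a0) \<le> e" "norm (a2 - a0) \<le> e" "norm (a3 - a0) \<le> e"
    using dist_triangle[of a0 a2 a1] dist_triangle[of a0 a3 a2]
      norm_ge_zero[of "a1 - a2"] norm_ge_zero[of "a2 - a3"]
    unfolding e_def dist_norm norm_minus_commute[of _ a0] by linarith+
  have near_a: "near 1 a0 a0" "near 1 a1 a0" "near 1 a2 a0" "near 1 a3 a0"
    using n d e0 by (simp_all add: near_def)
  have near_cnj: "near K (cnj x) (cnj y)" if "near K x y" for K x y
    using that unfolding near_def by (simp flip: complex_cnj_diff)
  have near_mult: "near (K + L) (x * x') (y * y')" if "near K x y" "near L x' y'" for K L x y x' y'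
  proof -
    have "norm (x * x' - y * y') = norm (x * (x' - y') + (x - y) * y')" by (simp add: algebra_simps)
    also have "\<dots> \<le> norm x * norm (x' - y') + norm (x - y) * norm y'"
      by (metis norm_mult norm_triangle_ineq)
    also have "\<dots> \<le> 1 * (L * e) + (K * e) * 1"
      using that unfolding near_def
      by (intro add_mono mult_mono) (auto intro: order.trans[OF norm_ge_zero])
    finally show ?thesis
      using that unfolding near_def by (simp add: norm_mult mult_le_one algebra_simps)
  qed
  have near_r: "near 2 (1 - x * cnj x) (1 - y * cnj y)" if "near 1 x y" for x y
  proof -
    have "near 2 (x * cnj x) (y * cnj y)"
      using near_mult[OF that near_cnj[OF that]] by simp
    moreover have "norm (1 - x * cnj x) \<le> 1" if "norm x \<le> 1" for x :: complex
    proof -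
      have "1 - x * cnj x = complex_of_real (1 - (norm x)\<^sup>2)"
        by (simp only: of_real_diff of_real_1 complex_norm_square)
      then have "norm (1 - x * cnj x) = \<bar>1 - (norm x)\<^sup>2\<bar>" by (simp only: norm_of_real)
      then show ?thesis using power_le_one[of "norm x" 2] that by simp
    qed
    ultimately show ?thesis using that unfolding near_def by (simp add: norm_minus_commute)
  qed
  define E where "E u1 u2 m1 m2 = (- 15/8) *\<^sub>R u1 + (3/4) *\<^sub>R u2 + (3/8) *\<^sub>R (u1 * u1) - (1/8) *\<^sub>R m1
      + (1/8) *\<^sub>R m2 - (1/8) *\<^sub>R (u1 * u2) - (1/24) *\<^sub>R (u1 * u1 * u1)" for u1 u2 m1 m2 :: complex
  define u1 u2 m1 m2 where "u1 b1 = - 1 * (a0 * cnj b1)"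
    and "u2 b1 b2 = - 1 * (a0 * (1 - b1 * cnj b1) * cnj b2)"
    and "m1 b1 b2 = a0 * (1 - b1 * cnj b1) * b1 * cnj b2 * cnj b2"
    and "m2 b1 b2 b3 = a0 * (1 - b1 * cnj b1) * (1 - b2 * cnj b2) * cnj b3" for b1 b2 b3 :: complex
  have ei: "entropy_increment a0 b1 b2 b3 = 2 * Re (E (u1 b1) (u2 b1 b2) (m1 b1 b2) (m2 b1 b2 b3))" for b1 b2 b3
    unfolding entropy_increment_def Let_def E_def u1_def u2_def m1_def m2_def
    by (rule arg_cong[of _ _ "\<lambda>x. 2 * Re x"]) (simp add: scaleR_conv_of_real field_simps power2_eq_square power3_eq_cube)
  have nm: "near 0 (- 1) (- 1)" by (simp add: near_def)
  note nr = near_r[OF near_a(2)] near_r[OF near_a(3)]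
  note nc = near_cnj[OF near_a(2)] near_cnj[OF near_a(3)] near_cnj[OF near_a(4)]
  have N1: "near 2 (u1 a1) (u1 a0)"
    using near_mult[OF nm near_mult[OF near_a(1) nc(1)]] by (simp add: u1_def)
  have N2: "near 4 (u2 a1 a2) (u2 a0 a0)"
    using near_mult[OF nm near_mult[OF near_mult[OF near_a(1) nr(1)] nc(2)]] by (simp add: u2_def)
  have N3: "near 6 (m1 a1 a2) (m1 a0 a0)"
    using near_mult[OF near_mult[OF near_mult[OF near_mult[OF near_a(1) nr(1)] near_a(2)] nc(2)] nc(2)]
    by (simp add: m1_def)
  have N4: "near 6 (m2 a1 a2 a3) (m2 a0 a0 a0)"
    using near_mult[OF near_mult[OF near_mult[OF near_a(1) nr(1)] nr(2)] nc(3)]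
    by (simp add: m2_def)
  have N5: "near 4 (u1 a1 * u1 a1) (u1 a0 * u1 a0)" using near_mult[OF N1 N1] by simp
  have N6: "near 6 (u1 a1 * u2 a1 a2) (u1 a0 * u2 a0 a0)" using near_mult[OF N1 N2] by simp
  have N7: "near 6 (u1 a1 * u1 a1 * u1 a1) (u1 a0 * u1 a0 * u1 a0)" using near_mult[OF N5 N1] by simp
  have Re_le: "Re x \<le> Re y + K * e" "Re y \<le> Re x + K * e" if "near K x y" for K x y
    using that abs_Re_le_cmod[of "x - y"] unfolding near_def by (simp_all add: abs_le_iff)
  \<comment> \<open>2*15/8 + 4*3/4 + 4*3/8 + 18/8 + 6/24 = 43/4 is below 11; the factor 2 in front
    of the real part then gives 22.\<close>
  have "\<bar>Re (E (u1 a1) (u2 a1 a2) (m1 a1 a2) (m2 a1 a2 a3)) - Re (E (u1 a0) (u2 a0 a0) (m1 a0 a0) (m2 a0 a0 a0))\<bar>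
      \<le> 11 * e"
  proof -
    have ReE: "Re (E v1 v2 v3 v4) = - 15/8 * Re v1 + 3/4 * Re v2 + 3/8 * Re (v1 * v1) - 1/8 * Re v3
       + 1/8 * Re v4 - 1/8 * Re (v1 * v2) - 1/24 * Re (v1 * v1 * v1)" for v1 v2 v3 v4
      unfolding E_def by (simp del: times_complex.sel)
    show ?thesis
      using Re_le[OF N1] Re_le[OF N2] Re_le[OF N3] Re_le[OF N4] Re_le[OF N5] Re_le[OF N6] Re_le[OF N7] e0
      unfolding ReE by (intro abs_leI) linarith+
  qed
  then show ?thesis unfolding ei e_def by linarith
qed

text \<open>The perturbation \<delta> changes g by a bounded amount in total, and what remains is
  monotone.\<close>

lemma telescoping_bounded_below_iff:
  fixes g \<delta> l :: "nat \<Rightarrow> real"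
  assumes step: "\<And>n. g (Suc n) = g n + \<delta> n - l n"
    and \<delta>: "summable (\<lambda>n. \<bar>\<delta> n\<bar>)" and l: "\<And>n. l n \<ge> 0"
  shows "(\<exists>C. \<forall>n. g n \<ge> C) \<longleftrightarrow> summable l"
proof -
  have g: "g n = g 0 + (\<Sum>i<n. \<delta> i) - (\<Sum>i<n. l i)" for n
    by (induction n) (simp_all add: step)
  have d: "\<bar>\<Sum>i<n. \<delta> i\<bar> \<le> (\<Sum>i. \<bar>\<delta> i\<bar>)" for n
    by (rule order.trans[OF sum_abs sum_le_suminf[OF \<delta>]]) auto
  show ?thesis
  proof
    assume "\<exists>C. \<forall>n. g n \<ge> C"
    then obtain C where C: "\<And>n. g n \<ge> C" by blast
    show "summable l"
    proof (rule summableI_nonneg_bounded)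
      show "(\<Sum>i<n. l i) \<le> g 0 + (\<Sum>i. \<bar>\<delta> i\<bar>) - C" for n
        using C[of n] g[of n] d[of n] by linarith
    qed (rule l)
  next
    assume s: "summable l"
    have "g n \<ge> g 0 - (\<Sum>i. \<bar>\<delta> i\<bar>) - suminf l" for n
      using g[of n] d[of n] sum_le_suminf[OF s, of "{..<n}"] l by (simp add: abs_le_iff) 
    then show "\<exists>C. \<forall>n. g n \<ge> C" by blast
  qed
qed

section \<open>The truncated logarithm\<close>

definition log_tail :: "real \<Rightarrow> real" where
  "log_tail x = - ln (1 - x) - x - x^2 / 2 - x^3 / 3"

text \<open>The derivative t^3 / (1 - t) is at least t^3, and at most 2 t^3 as long as t <= 1/2. The
  upper bound has to stay away from 1, where the logarithm is unbounded.\<close>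

lemma log_tail_bounds:
  assumes "0 \<le> x" "x < 1"
  shows "x^4 / 4 \<le> log_tail x" and "x \<le> 1/2 \<Longrightarrow> log_tail x \<le> x^4 / 2"
proof -
  have deriv: "(log_tail has_real_derivative t^3 / (1 - t)) (at t)" if "0 \<le> t" "t < 1" for t
    unfolding log_tail_def using that
    by (auto intro!: derivative_eq_intros simp: field_simps power2_eq_square power3_eq_cube)
  have 0: "log_tail 0 = 0" by (simp add: log_tail_def)
  have "log_tail 0 - 0^4/4 \<le> log_tail x - x^4/4"
  proof (rule DERIV_nonneg_imp_nondecreasing[OF assms(1)])
    fix t assume t: "0 \<le> t" "t \<le> x"
    have "((\<lambda>x. log_tail x - x^4/4) has_real_derivative t^3 / (1 - t) - t^3) (at t)"
      using t assms by (auto intro!: derivative_eq_intros deriv)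
    moreover have "t^3 / (1 - t) - t^3 \<ge> 0"
      using t assms by (simp add: field_simps)
    ultimately show "\<exists>y. ((\<lambda>x. log_tail x - x^4/4) has_real_derivative y) (at t) \<and> 0 \<le> y" by blast
  qed
  then show "x^4 / 4 \<le> log_tail x" by (simp add: 0)
  assume half: "x \<le> 1/2"
  have "0^4/2 - log_tail 0 \<le> x^4/2 - log_tail x"
  proof (rule DERIV_nonneg_imp_nondecreasing[OF assms(1)])
    fix t assume t: "0 \<le> t" "t \<le> x"
    have "((\<lambda>x. x^4/2 - log_tail x) has_real_derivative 2 * t^3 - t^3 / (1 - t)) (at t)"
      using t assms by (auto intro!: derivative_eq_intros deriv)
    moreover have "2 * t^3 - t^3 / (1 - t) \<ge> 0"
    proof -
      have "t^3 \<le> t^3 * (2 * (1 - t))"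
        using t half mult_left_mono[of 1 "2 * (1 - t)" "t^3"] by simp
      then show ?thesis using t assms by (simp add: divide_le_eq algebra_simps)
    qed
    ultimately show "\<exists>y. ((\<lambda>x. x^4/2 - log_tail x) has_real_derivative y) (at t) \<and> 0 \<le> y" by blast
  qed
  then show "log_tail x \<le> x^4 / 2" by (simp add: 0)
qed

lemma summable_log_tail_iff:
  fixes x :: "nat \<Rightarrow> real"
  assumes "\<And>n. 0 \<le> x n" "\<And>n. x n < 1"
  shows "summable (\<lambda>n. log_tail (x n)) \<longleftrightarrow> summable (\<lambda>n. x n ^ 4)"
proof
  assume "summable (\<lambda>n. log_tail (x n))"
  then have "summable (\<lambda>n. 4 * log_tail (x n))" by (rule summable_mult)
  then show "summable (\<lambda>n. x n ^ 4)"
    by (rule summable_comparison_test'[of _ 0])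
       (use log_tail_bounds(1)[OF assms] assms(1) in \<open>auto simp: field_simps\<close>)
next
  assume s: "summable (\<lambda>n. x n ^ 4)"
  \<comment> \<open>Summability forces x_n to 0, so the upper bound for \<open>log_tail\<close> is
    available from some index on.\<close>
  then have "(\<lambda>n. x n ^ 4) \<longlonglongrightarrow> 0" by (rule summable_LIMSEQ_zero)
  then have "eventually (\<lambda>n. x n ^ 4 < (1/2)^4) sequentially"
    by (rule order_tendstoD) simp
  then have "eventually (\<lambda>n. x n < 1/2) sequentially"
    by (rule eventually_mono) (rule power_less_imp_less_base[of _ 4], auto)
  then obtain N where "\<And>n. n \<ge> N \<Longrightarrow> x n < 1/2"
    by (auto simp: eventually_sequentially)
  then have le: "log_tail (x n) \<le> x n ^ 4 / 2" if "n \<ge> N" for n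
    using log_tail_bounds(2)[OF assms, of n] that less_imp_le by blast
  have "norm (log_tail (x n)) \<le> x n ^ 4 / 2" if "n \<ge> N" for n
    using le[OF that] log_tail_bounds(1)[OF assms, of n] zero_le_power[OF assms(1)[of n], of 4]
    by simp
  moreover have "summable (\<lambda>n. x n ^ 4 / 2)" using s by (rule summable_divide)
  ultimately show "summable (\<lambda>n. log_tail (x n))"
    by - (rule summable_comparison_test'[of "\<lambda>n. x n ^ 4 / 2" N], auto)
qed

lemma (in verblunsky_seq) bs_entropy_bounded_below_iff:
  assumes bv: "summable (\<lambda>n. norm (\<alpha> (Suc n) - \<alpha> n))"
  shows "(\<exists>C. \<forall>n. bs_entropy n \<ge> C) \<longleftrightarrow> \<alpha> \<in> ell 8"
proof -
  let ?D = "\<lambda>n. norm (\<alpha> (Suc n) - \<alpha> n)"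
  define x where "x n = (norm (\<alpha> n))\<^sup>2" for n
  have x: "0 \<le> x n" "x n < 1" for n
    using norm_alpha[of n] by (simp_all add: x_def abs_square_less_1)
  \<comment> \<open>What the logarithm retains after the diagonal polynomial is absorbed; 5/2 is the
    mean of (1 - cos \<theta>)^3.\<close>
  define l where "l n = 5/2 * log_tail (x (n + 3))" for n
  define \<delta> where "\<delta> n = entropy_increment (\<alpha> (n+3)) (\<alpha> (n+2)) (\<alpha> (n+1)) (\<alpha> n)
      - entropy_increment (\<alpha> (n+3)) (\<alpha> (n+3)) (\<alpha> (n+3)) (\<alpha> (n+3))" for n
  have step: "bs_entropy (Suc n + 3) = bs_entropy (n + 3) + \<delta> n - l n" for n
  proof -
    have e: "n + 1 = Suc n" "n + 2 = Suc (Suc n)" "n + 3 = Suc (Suc (Suc n))"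
      "Suc n + 3 = Suc (Suc (Suc (Suc n)))" by simp_all
    let ?a = "\<alpha> (Suc (Suc (Suc n)))"
    have "log_tail ((norm ?a)\<^sup>2) = - ln (rho2 (Suc (Suc (Suc n)))) - (norm ?a)\<^sup>2 - norm ?a ^ 4 / 2 - norm ?a ^ 6 / 3"
      by (simp add: log_tail_def rho2_def flip: power_mult)
    then have "5/2 * log_tail ((norm ?a)\<^sup>2)
        = - (5/2 * ln (rho2 (Suc (Suc (Suc n))))) - entropy_increment ?a ?a ?a ?a"
      unfolding entropy_increment_constant by argo
    then show ?thesis
      unfolding \<delta>_def l_def x_def e bs_entropy_Suc[of n] by argo
  qed
  have "\<bar>\<delta> n\<bar> \<le> 22 * (?D (n+2) + ?D (n+1) + ?D n)" for n
  proof -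
    have "norm (\<alpha> k) \<le> 1" for k using norm_alpha[of k] by simp
    then have "\<bar>\<delta> n\<bar> \<le> 22 * (norm (\<alpha> (n+3) - \<alpha> (n+2)) + norm (\<alpha> (n+2) - \<alpha> (n+1)) + norm (\<alpha> (n+1) - \<alpha> n))"
      unfolding \<delta>_def by (intro entropy_increment_lipschitz) auto
    then show ?thesis by (simp add: numeral_2_eq_2 numeral_3_eq_3)
  qed
  moreover have "summable (\<lambda>n. 22 * (?D (n+2) + ?D (n+1) + ?D n))"
    using bv by (intro summable_mult summable_add summable_ignore_initial_segment)
  ultimately have \<delta>: "summable (\<lambda>n. \<bar>\<delta> n\<bar>)"
    by - (rule summable_comparison_test'[of "\<lambda>n. 22 * (?D (n+2) + ?D (n+1) + ?D n)" 0], auto)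
  have l: "l n \<ge> 0" for n
    using log_tail_bounds(1)[OF x, of "n+3"] zero_le_power[OF x(1)[of "n+3"], of 4]
    unfolding l_def by linarith
  \<comment> \<open>The step formula begins at index 3; the three earlier entropies can only change
    the value of the lower bound.\<close>
  have "(\<exists>C. \<forall>n. bs_entropy n \<ge> C) \<longleftrightarrow> (\<exists>C. \<forall>n. bs_entropy (n + 3) \<ge> C)"
  proof
    assume "\<exists>C. \<forall>n. bs_entropy (n + 3) \<ge> C"
    then obtain C where C: "\<And>n. bs_entropy (n + 3) \<ge> C" by blast
    have "bs_entropy n \<ge> min C (min (bs_entropy 0) (min (bs_entropy 1) (bs_entropy 2)))" for n
    proof (cases "n \<ge> 3")
      case True
      with C[of "n - 3"] show ?thesis by simp
    next
      case False
      then have "n = 0 \<or> n = 1 \<or> n = 2" by auto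
      then show ?thesis by auto
    qed
    then show "\<exists>C. \<forall>n. bs_entropy n \<ge> C" by blast
  qed blast
  also have "\<dots> \<longleftrightarrow> summable l"
    by (rule telescoping_bounded_below_iff[OF step \<delta> l])
  also have "\<dots> \<longleftrightarrow> summable (\<lambda>n. log_tail (x (n + 3)))"
    unfolding l_def by (rule summable_cmult_iff[THEN trans]) simp
  also have "\<dots> \<longleftrightarrow> summable (\<lambda>n. x (n + 3) ^ 4)"
    using x by (intro summable_log_tail_iff)
  also have "\<dots> \<longleftrightarrow> summable (\<lambda>n. x n ^ 4)"
    by (rule summable_iff_shift)
  also have "(\<lambda>n. x n ^ 4) = (\<lambda>n. norm (\<alpha> n) powr 8)"
    by (simp add: x_def powr_numeral flip: power_mult)
  finally show ?thesis by (simp add: ell_def)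
qed

section \<open>Density of continuous functions\<close>

text \<open>Allows approximation in L^1 of two measures by one and the same continuous
  function.\<close>

definition sum_measure :: "'a measure \<Rightarrow> 'a measure \<Rightarrow> 'a measure" where
  "sum_measure M N = measure_of (space M) (sets M) (\<lambda>A. emeasure M A + emeasure N A)"

lemma sets_sum_measure [simp]: "sets (sum_measure M N) = sets M"
  and space_sum_measure [simp]: "space (sum_measure M N) = space M"
  by (simp_all add: sum_measure_def sets.sigma_sets_eq)

lemma emeasure_sum_measure:
  assumes "sets M = sets N" "A \<in> sets M"
  shows "emeasure (sum_measure M N) A = emeasure M A + emeasure N A"
  unfolding sum_measure_def
proof (rule emeasure_measure_of_sigma)
  show "countably_additive (sets M) (\<lambda>A. emeasure M A + emeasure N A)"
  proof (rule countably_additiveI)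
    fix B :: "nat \<Rightarrow> _" assume B: "range B \<subseteq> sets M" "disjoint_family B"
    then show "(\<Sum>i. emeasure M (B i) + emeasure N (B i)) = emeasure M (\<Union>i. B i) + emeasure N (\<Union>i. B i)"
      using assms(1) by (simp add: suminf_add[symmetric] suminf_emeasure)
  qed
  show "sigma_algebra (space M) (sets M)" by (rule sets.sigma_algebra_axioms)
qed (use assms in \<open>auto simp: positive_def\<close>)

lemma le_sum_measure:
  assumes "sets M = sets N"
  shows "M \<le> sum_measure M N" "N \<le> sum_measure M N"
  using assms sets_eq_imp_space_eq[OF assms]
  by (auto simp: le_measure emeasure_sum_measure)

lemma finite_measure_sum_measure:
  assumes "finite_measure M" "finite_measure N" "sets M = sets N"
  shows "finite_measure (sum_measure M N)"
proof (rule finite_measureI)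
  show "emeasure (sum_measure M N) (space (sum_measure M N)) \<noteq> \<infinity>"
    using assms sets_eq_imp_space_eq[OF assms(3)]
      finite_measure.emeasure_finite[OF assms(1), of "space M"] finite_measure.emeasure_finite[OF assms(2), of "space N"]
    by (simp add: emeasure_sum_measure)
qed

text \<open>An indicator is squeezed between a compact and an open set by regularity and replaced by
  a Urysohn function; sums and dominated limits follow.\<close>

lemma continuous_dense_L1:
  fixes f :: "'a::euclidean_space \<Rightarrow> real"
  assumes M: "finite_measure M" "sets M = sets borel" and f: "integrable M f"
  shows "\<forall>e>0. \<exists>g. continuous_on UNIV g \<and> (\<integral>\<^sup>+x. ennreal \<bar>f x - g x\<bar> \<partial>M) < ennreal e"
  using f
proof (induction rule: integrable_induct)
  case (base A c)
  interpret finite_measure M by fact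
  note [measurable_cong] = M(2)
  show ?case
  proof (intro allI impI)
    fix e :: real assume "e > 0"
    \<comment> \<open>The two regularity errors give 2 e' for the measure of U - K, to be scaled by
      |c|; the summand 1 covers c = 0 and makes the final inequality strict.\<close>
    define e' where "e' = e / (2 * (\<bar>c\<bar> + 1))"
    have e': "e' > 0" using \<open>e > 0\<close> by (simp add: e'_def)
    have A: "A \<in> sets borel" using base M by simp
    have fin: "emeasure M (space M) \<noteq> \<infinity>" by simp
    have fin_A: "emeasure M A \<noteq> \<infinity>" by simp
    have "{K. K \<subseteq> A \<and> compact K} \<noteq> {}" by auto
    then obtain K where K: "K \<subseteq> A" "compact K" "emeasure M A < emeasure M K + ennreal e'"
      using SUP_approx_ennreal[OF e' _ inner_regular[OF M(2) fin A] fin_A] by (metis (no_types, lifting) mem_Collect_eq)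
    obtain U where U: "A \<subseteq> U" "open U" "emeasure M U < emeasure M A + ennreal e'"
      using INF_approx_ennreal[OF e' outer_regular[OF M(2) fin A] fin_A] by auto
    obtain g :: "'a \<Rightarrow> real" where g: "continuous_on UNIV g" "\<And>x. g x \<in> closed_segment 0 1"
      "\<And>x. x \<in> - U \<Longrightarrow> g x = 0" "\<And>x. x \<in> K \<Longrightarrow> g x = 1"
      by (rule Urysohn[of "- U" K 0 1]) (use K U compact_imp_closed in auto)
    have g01: "0 \<le> g x" "g x \<le> 1" for x
      using g(2)[of x] by (auto simp: closed_segment_eq_real_ivl)
    have KU: "K \<in> sets M" "U \<in> sets M" using K U M by (auto simp: compact_imp_closed)
    have "\<bar>indicator A x *\<^sub>R c - c * g x\<bar> \<le> \<bar>c\<bar> * indicator (U - K) x" for x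
    proof -
      have "\<bar>indicator A x - g x\<bar> \<le> indicator (U - K) x"
        using g01[of x] g(3,4)[of x] K(1) U(1) by (auto simp: indicator_def)
      then have "\<bar>c\<bar> * \<bar>indicator A x - g x\<bar> \<le> \<bar>c\<bar> * indicator (U - K) x"
        by (intro mult_left_mono) auto
      then show ?thesis by (simp add: algebra_simps flip: abs_mult)
    qed
    then have "(\<integral>\<^sup>+x. ennreal \<bar>indicator A x *\<^sub>R c - c * g x\<bar> \<partial>M)
        \<le> (\<integral>\<^sup>+x. ennreal \<bar>c\<bar> * indicator (U - K) x \<partial>M)"
      by (intro nn_integral_mono) (simp add: ennreal_indicator[symmetric] ennreal_mult'[symmetric])
    also have "\<dots> = ennreal \<bar>c\<bar> * emeasure M (U - K)"
      using KU by (subst nn_integral_cmult_indicator) auto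
    also have "emeasure M (U - K) \<le> ennreal (2 * e')"
    proof -
      have "measure M U < measure M A + e'" "measure M A < measure M K + e'"
        using U(3) K(3) e' by (simp_all add: emeasure_eq_measure ennreal_plus[symmetric] ennreal_less_iff
            del: ennreal_plus)
      then have "measure M (U - K) \<le> 2 * e'"
        using KU K(1) U(1) by (subst finite_measure_Diff) auto
      then show ?thesis using e' by (simp add: emeasure_eq_measure)
    qed
    also have "ennreal \<bar>c\<bar> * ennreal (2 * e') = ennreal (\<bar>c\<bar> * (2 * e'))"
      using e' by (simp add: ennreal_mult)
    also have "\<bar>c\<bar> * (2 * e') < e"
      using \<open>e > 0\<close> by (simp add: e'_def field_simps)
    then have "ennreal (\<bar>c\<bar> * (2 * e')) < ennreal e"
      using \<open>e > 0\<close> by (intro ennreal_lessI) auto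
    finally have "(\<integral>\<^sup>+x. ennreal \<bar>indicator A x *\<^sub>R c - c * g x\<bar> \<partial>M) < ennreal e"
      by (simp add: mult_left_mono)
    then show "\<exists>g. continuous_on UNIV g \<and> (\<integral>\<^sup>+x. ennreal \<bar>indicator A x *\<^sub>R c - g x\<bar> \<partial>M) < ennreal e"
      using g(1) by (intro exI[of _ "\<lambda>x. c * g x"]) (auto intro!: continuous_intros)
  qed
next
  case (add f1 f2)
  note [measurable_cong] = M(2)
  note [measurable] = borel_measurable_integrable[OF add(1)] borel_measurable_integrable[OF add(2)]
  show ?case
  proof (intro allI impI)
    fix e :: real assume "e > 0"
    then have e2: "e / 2 > 0" by simp
    obtain g1 where g1: "continuous_on UNIV g1" "(\<integral>\<^sup>+x. ennreal \<bar>f1 x - g1 x\<bar> \<partial>M) < ennreal (e/2)"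
      using add(3) e2 by blast
    obtain g2 where g2: "continuous_on UNIV g2" "(\<integral>\<^sup>+x. ennreal \<bar>f2 x - g2 x\<bar> \<partial>M) < ennreal (e/2)"
      using add(4) e2 by blast
    have [measurable]: "g1 \<in> borel_measurable borel" "g2 \<in> borel_measurable borel"
      using g1 g2 by (auto intro: borel_measurable_continuous_onI)
    have "(\<integral>\<^sup>+x. ennreal \<bar>f1 x + f2 x - (g1 x + g2 x)\<bar> \<partial>M)
        \<le> (\<integral>\<^sup>+x. ennreal \<bar>f1 x - g1 x\<bar> + ennreal \<bar>f2 x - g2 x\<bar> \<partial>M)"
      by (intro nn_integral_mono) (auto simp flip: ennreal_plus)
    also have "\<dots> = (\<integral>\<^sup>+x. ennreal \<bar>f1 x - g1 x\<bar> \<partial>M) + (\<integral>\<^sup>+x. ennreal \<bar>f2 x - g2 x\<bar> \<partial>M)"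
      by (rule nn_integral_add) measurable
    also have "\<dots> < ennreal (e/2) + ennreal (e/2)"
      by (rule add_strict_mono[OF g1(2) g2(2)])
    also have "\<dots> = ennreal e" using \<open>e > 0\<close> by (simp flip: ennreal_plus)
    finally show "\<exists>g. continuous_on UNIV g \<and> (\<integral>\<^sup>+x. ennreal \<bar>f1 x + f2 x - g x\<bar> \<partial>M) < ennreal e"
      using g1 g2 by (intro exI[of _ "\<lambda>x. g1 x + g2 x"]) (auto intro!: continuous_intros)
  qed
next
  case (lim f s)
  note [measurable_cong] = M(2)
  note [measurable] = borel_measurable_integrable[OF lim(4)] borel_measurable_integrable[OF lim(1)]
  show ?case
  proof (intro allI impI)
    fix e :: real assume "e > 0"
    then have e2: "e / 2 > 0" by simp
    have "(\<lambda>i. \<integral>\<^sup>+x. norm (f x - s i x) \<partial>M) \<longlonglongrightarrow> 0"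
    proof (rule nn_integral_dominated_convergence_norm[where w = "\<lambda>x. 2 * norm (f x)"])
      show "(\<integral>\<^sup>+x. ennreal (2 * norm (f x)) \<partial>M) < \<infinity>"
        using integrable_mult_right[OF integrable_norm[OF lim(4)], of 2]
        by (subst nn_integral_eq_integral) auto
    qed (use lim in auto)
    then have "\<forall>\<^sub>F i in sequentially. (\<integral>\<^sup>+x. norm (f x - s i x) \<partial>M) < ennreal (e/2)"
      by (rule order_tendstoD(2)) (use e2 in simp)
    then obtain i where i: "(\<integral>\<^sup>+x. norm (f x - s i x) \<partial>M) < ennreal (e/2)"
      by (meson eventually_happens' sequentially_bot)
    obtain g where g: "continuous_on UNIV g" "(\<integral>\<^sup>+x. ennreal \<bar>s i x - g x\<bar> \<partial>M) < ennreal (e/2)"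
      using lim(5) e2 by blast
    have [measurable]: "g \<in> borel_measurable borel"
      using g by (auto intro: borel_measurable_continuous_onI)
    have "(\<integral>\<^sup>+x. ennreal \<bar>f x - g x\<bar> \<partial>M)
        \<le> (\<integral>\<^sup>+x. ennreal (norm (f x - s i x)) + ennreal \<bar>s i x - g x\<bar> \<partial>M)"
      by (intro nn_integral_mono) (auto simp flip: ennreal_plus)
    also have "\<dots> = (\<integral>\<^sup>+x. norm (f x - s i x) \<partial>M) + (\<integral>\<^sup>+x. ennreal \<bar>s i x - g x\<bar> \<partial>M)"
      by (rule nn_integral_add) measurable
    also have "\<dots> < ennreal (e/2) + ennreal (e/2)"
      by (rule add_strict_mono[OF i g(2)])
    also have "\<dots> = ennreal e" using \<open>e > 0\<close> by (simp flip: ennreal_plus)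
    finally show "\<exists>g. continuous_on UNIV g \<and> (\<integral>\<^sup>+x. ennreal \<bar>f x - g x\<bar> \<partial>M) < ennreal e"
      using g(1) by blast
  qed
qed

section \<open>Entropy bounds\<close>

text \<open>Laurent polynomials that are real on the circle. The form z^(-m) p(z), with cnj z for
  1/z, is the one to which the moment comparison applies.\<close>

definition trig_poly :: "(complex \<Rightarrow> real) \<Rightarrow> bool" where
  "trig_poly g \<longleftrightarrow> (\<exists>m p. \<forall>z. norm z = 1 \<longrightarrow> complex_of_real (g z) = cnj z ^ m * poly p z)"

lemma trig_poly_const: "trig_poly (\<lambda>z. c)"
  unfolding trig_poly_def by (rule exI[of _ 0], rule exI[of _ "[:of_real c:]"]) simp

lemma trig_poly_mult:
  assumes "trig_poly f" "trig_poly g"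
  shows "trig_poly (\<lambda>z. f z * g z)"
proof -
  obtain m p where p: "\<And>z. norm z = 1 \<Longrightarrow> complex_of_real (f z) = cnj z ^ m * poly p z"
    using assms(1) unfolding trig_poly_def by blast
  obtain n q where q: "\<And>z. norm z = 1 \<Longrightarrow> complex_of_real (g z) = cnj z ^ n * poly q z"
    using assms(2) unfolding trig_poly_def by blast
  have "norm z = 1 \<Longrightarrow> complex_of_real (f z * g z) = cnj z ^ (m + n) * poly (p * q) z" for z
    by (simp add: p q power_add)
  then show ?thesis unfolding trig_poly_def by blast
qed

lemma trig_poly_add:
  assumes "trig_poly f" "trig_poly g"
  shows "trig_poly (\<lambda>z. f z + g z)"
proof -
  obtain m p where p: "\<And>z. norm z = 1 \<Longrightarrow> complex_of_real (f z) = cnj z ^ m * poly p z"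
    using assms(1) unfolding trig_poly_def by blast
  obtain n q where q: "\<And>z. norm z = 1 \<Longrightarrow> complex_of_real (g z) = cnj z ^ n * poly q z"
    using assms(2) unfolding trig_poly_def by blast
  have "complex_of_real (f z + g z) = cnj z ^ (m + n) * poly (monom 1 n * p + monom 1 m * q) z"
    if z: "norm z = 1" for z
  proof -
    have "cnj z * z = 1" using z by (simp add: complex_norm_square[symmetric] mult.commute)
    then have "cnj z ^ k * z ^ k = 1" for k by (simp flip: power_mult_distrib)
    then have 1: "cnj z ^ k * (z ^ k * x) = x" for k x by (simp flip: mult.assoc)
    have "cnj z ^ (m + n) * poly (monom 1 n * p + monom 1 m * q) z
        = cnj z ^ m * (cnj z ^ n * (z ^ n * poly p z)) + cnj z ^ n * (cnj z ^ m * (z ^ m * poly q z))"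
      by (simp add: poly_monom power_add algebra_simps)
    then show ?thesis unfolding 1 by (simp add: p[OF z] q[OF z])
  qed
  then show ?thesis unfolding trig_poly_def by blast
qed

lemma trig_poly_Re: "trig_poly Re" and trig_poly_Im: "trig_poly Im"
proof -
  have zz: "cnj z * z = 1" if "norm z = 1" for z
    using that by (simp add: complex_norm_square[symmetric] mult.commute)
  have "complex_of_real (Re z) = cnj z ^ 1 * poly [:1/2, 0, 1/2:] z" if "norm z = 1" for z
  proof -
    have "complex_of_real (Re z) = (cnj z + z) / 2" by (simp add: complex_eq_iff)
    also have "\<dots> = (cnj z + (cnj z * z) * z) / 2" by (simp add: zz[OF that])
    finally show ?thesis by (simp add: field_simps)
  qed
  then show "trig_poly Re" unfolding trig_poly_def by blast
  have "complex_of_real (Im z) = cnj z ^ 1 * poly [:\<i>/2, 0, -\<i>/2:] z" if "norm z = 1" for z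
  proof -
    have "complex_of_real (Im z) = (\<i> * cnj z - \<i> * z) / 2" by (simp add: complex_eq_iff)
    also have "\<dots> = (\<i> * cnj z - \<i> * ((cnj z * z) * z)) / 2" by (simp add: zz[OF that])
    finally show ?thesis by (simp add: field_simps)
  qed
  then show "trig_poly Im" unfolding trig_poly_def by blast
qed

text \<open>Connects Stone--Weierstrass, which yields polynomials in Re z and Im z, with the
  moments: on the circle both coordinates are Laurent polynomials.\<close>

lemma trig_poly_real_polynomial_function:
  assumes "real_polynomial_function (g :: complex \<Rightarrow> real)"
  shows "trig_poly g"
  using assms
proof induction
  case (linear f)
  interpret bounded_linear f by fact
  have "f z = Re z * f 1 + Im z * f \<i>" for z
  proof -
    have "z = Re z *\<^sub>R 1 + Im z *\<^sub>R \<i>" by (simp add: complex_eq_iff)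
    then show ?thesis by (metis add scaleR real_scaleR_def)
  qed
  then have "f = (\<lambda>z. Re z * f 1 + Im z * f \<i>)" by blast
  moreover have "trig_poly (\<lambda>z. Re z * f 1 + Im z * f \<i>)"
    by (intro trig_poly_add trig_poly_mult trig_poly_Re trig_poly_Im trig_poly_const)
  ultimately show ?case by simp
qed (intro trig_poly_const trig_poly_add trig_poly_mult; assumption)+

definition cos_weight :: "complex \<Rightarrow> real" where
  "cos_weight z = (1 - Re z) ^ 3"

lemma cos_weight_continuous [continuous_intros]: "continuous_on A cos_weight"
  unfolding cos_weight_def by (intro continuous_intros)

lemma cos_weight_measurable [measurable]: "cos_weight \<in> borel_measurable borel"
  by (intro borel_measurable_continuous_onI continuous_intros)

text \<open>The bound 8 = 2^3, reached at z = -1, is the origin of the factors 8 and 16 in the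
  estimates below.\<close>

lemma cos_weight_bounds:
  assumes "norm z = 1"
  shows "0 \<le> cos_weight z" "cos_weight z \<le> 8"
proof -
  have "-1 \<le> Re z" "Re z \<le> 1" using abs_Re_le_cmod[of z] assms by linarith+
  then show "0 \<le> cos_weight z" "cos_weight z \<le> 8"
    using power_mono[of "1 - Re z" 2 3] by (simp_all add: cos_weight_def)
qed

lemma trig_poly_cos_weight: "trig_poly cos_weight"
proof -
  have "cos_weight = (\<lambda>z. (1 + (-1) * Re z) * ((1 + (-1) * Re z) * (1 + (-1) * Re z)))"
    by (simp add: cos_weight_def power3_eq_cube fun_eq_iff)
  moreover have "trig_poly (\<lambda>z. (1 + (-1) * Re z) * ((1 + (-1) * Re z) * (1 + (-1) * Re z)))"
    by (intro trig_poly_add trig_poly_mult trig_poly_Re trig_poly_const)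
  ultimately show ?thesis by simp
qed

section \<open>A variational inequality from a lower entropy bound\<close>

locale opuc = verblunsky_circle_measure +
  assumes orth: "\<And>n. orth n" and mass: "measure M UNIV = 1"
begin

sublocale circle: circle_measure circle_lebesgue
  by (rule circle_measure_circle_lebesgue)

lemma bs_entropy_eq: "bs_entropy n = (LINT z|circle_lebesgue. cos_weight z * ln (bs_weight n z))"
  unfolding bs_entropy_def circle_lebesgue_def by (subst integral_distr) (simp_all add: cos_weight_def)

lemma integrable_bounded_circle:
  assumes "circle_measure L" and [measurable]: "h \<in> borel_measurable borel"
    and "\<And>z. norm z = 1 \<Longrightarrow> \<bar>h z\<bar> \<le> (B::real)"
  shows "integrable L h"
proof -
  interpret L: circle_measure L by fact
  show ?thesis
    by (rule L.integrable_const_bound[of _ B]) (use L.AE_norm assms(3) in \<open>auto elim!: eventually_mono\<close>)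
qed

lemma integral_trig_poly_bs:
  assumes "trig_poly g" "continuous_on UNIV g"
  obtains n where "(LINT z|bs n. g z) = (LINT z|M. g z)"
proof -
  obtain m p where p: "\<And>z. norm z = 1 \<Longrightarrow> complex_of_real (g z) = cnj z ^ m * poly p z"
    using assms(1) unfolding trig_poly_def by blast
  have eq: "complex_of_real (LINT z|L. g z) = (LINT z|L. cnj z ^ m * poly p z)" if "circle_measure L" for L
    unfolding integral_complex_of_real[symmetric]
    by (rule circle_measure.integral_circle_cong[OF that p]) (auto intro!: continuous_intros assms(2))
  have "complex_of_real (LINT z|bs (max m (degree p)). g z) = of_real (LINT z|M. g z)"
    unfolding eq[OF circle_measure_bs] eq[OF circle_measure_axioms]
    by (rule integral_bs_eq) (simp_all add: orth mass)
  then show ?thesis using that by (simp only: of_real_eq_iff)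
qed

context
  fixes C assumes C: "\<And>n. bs_entropy n \<ge> C"
begin

text \<open>With f the weight, f log(w_n h) <= f w_n h is integrated for an n at which the Laurent
  polynomial f h has the same integral against w_n and \<mu>. The entropy of w_n on the left is at
  least C for every n, so n disappears from the result.\<close>

lemma entropy_bound_trig_poly:
  assumes h: "trig_poly h" "continuous_on UNIV h" and pos: "\<And>z. norm z = 1 \<Longrightarrow> h z > 0"
  shows "C + (LINT z|circle_lebesgue. cos_weight z * ln (h z)) \<le> (LINT z|M. cos_weight z * h z)"
proof -
  obtain n where n: "(LINT z|bs n. cos_weight z * h z) = (LINT z|M. cos_weight z * h z)"
    using integral_trig_poly_bs[OF trig_poly_mult[OF trig_poly_cos_weight h(1)]
      continuous_on_mult[OF cos_weight_continuous h(2)]] by blast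
  have [measurable]: "h \<in> borel_measurable borel" using h(2) by (rule borel_measurable_continuous_onI)
  have ccis: "continuous_on UNIV (\<lambda>\<theta>. g (cis \<theta>))" if "continuous_on UNIV g" for g :: "complex \<Rightarrow> real"
    using that by (rule continuous_on_compose2) (auto intro!: continuous_intros)
  have hc: "continuous_on UNIV (\<lambda>\<theta>. h (cis \<theta>))" by (rule ccis[OF h(2)])
  have wc: "continuous_on UNIV (\<lambda>\<theta>. cos_weight (cis \<theta>))" by (rule ccis[OF cos_weight_continuous])
  have hl: "continuous_on UNIV (\<lambda>\<theta>. ln (h (cis \<theta>)))"
  proof (intro continuous_intros hc ballI)
    show "h (cis \<theta>) \<noteq> 0" for \<theta> using pos[of "cis \<theta>"] by simp
  qed
  have distr: "(LINT z|circle_lebesgue. g z) = (LINT \<theta>|angle_measure. g (cis \<theta>))"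
    if "g \<in> borel_measurable borel" for g :: "complex \<Rightarrow> real"
    unfolding circle_lebesgue_def using that by (subst integral_distr) simp_all
  have "C + (LINT z|circle_lebesgue. cos_weight z * ln (h z))
      \<le> (LINT \<theta>|angle_measure. cos_weight (cis \<theta>) * ln (bs_weight n (cis \<theta>)))
        + (LINT \<theta>|angle_measure. cos_weight (cis \<theta>) * ln (h (cis \<theta>)))"
    using C[of n] unfolding bs_entropy_eq by (simp add: distr)
  also have "\<dots> = (LINT \<theta>|angle_measure. cos_weight (cis \<theta>) * ln (bs_weight n (cis \<theta>))
        + cos_weight (cis \<theta>) * ln (h (cis \<theta>)))"
    by (intro Bochner_Integration.integral_add[symmetric] angle_continuous continuous_intros wc hl
        ln_bs_weight_continuous)
  also have "\<dots> \<le> (LINT \<theta>|angle_measure. bs_weight n (cis \<theta>) *\<^sub>R (cos_weight (cis \<theta>) * h (cis \<theta>)))"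
  proof (intro integral_mono angle_continuous continuous_intros wc hl hc ln_bs_weight_continuous bs_weight_continuous)
    fix \<theta>
    let ?z = "cis \<theta>"
    have b: "bs_weight n ?z > 0" "h ?z > 0" using bs_weight_pos[of ?z n] pos[of ?z] by simp_all
    have "ln (bs_weight n ?z) + ln (h ?z) = ln (bs_weight n ?z * h ?z)" using b by (simp add: ln_mult)
    also have "\<dots> \<le> bs_weight n ?z * h ?z"
      using b ln_le_minus_one[of "bs_weight n ?z * h ?z"] by simp
    finally have "cos_weight ?z * (ln (bs_weight n ?z) + ln (h ?z)) \<le> cos_weight ?z * (bs_weight n ?z * h ?z)"
      using cos_weight_bounds[of ?z] by (intro mult_left_mono) auto
    then show "cos_weight ?z * ln (bs_weight n ?z) + cos_weight ?z * ln (h ?z)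
        \<le> bs_weight n ?z *\<^sub>R (cos_weight ?z * h ?z)"
      by (simp add: algebra_simps)
  qed (use bs_weight_pos[of "cis _" n] pos[of "cis _"] in \<open>simp_all add: less_imp_neq[symmetric]\<close>)
  also have "\<dots> = (LINT z|bs n. cos_weight z * h z)"
    by (rule integral_bs[symmetric]) measurable
  finally show ?thesis unfolding n .
qed

lemma entropy_bound_continuous:
  assumes h: "continuous_on UNIV h" and \<delta>: "\<delta> > 0" "\<And>z. h z \<ge> \<delta>"
  shows "C + (LINT z|circle_lebesgue. cos_weight z * ln (h z)) \<le> (LINT z|M. cos_weight z * h z)"
proof (rule field_le_epsilon)
  fix e :: real assume "e > 0"
  define \<eta> where "\<eta> = e / 16"
  have \<eta>: "\<eta> > 0" using \<open>e > 0\<close> by (simp add: \<eta>_def)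
  obtain g where g: "real_polynomial_function g" "\<And>z. z \<in> sphere 0 1 \<Longrightarrow> \<bar>h z - g z\<bar> < \<eta>"
    using Stone_Weierstrass_real_polynomial_function[of "sphere 0 1" h \<eta>] continuous_on_subset[OF h] \<eta>
    by (metis compact_sphere subset_UNIV)
  \<comment> \<open>Raising g by \<eta> puts k between h and h + 2 \<eta> on the circle, hence k > 0
    there; with the weight at most 8 the right side grows by at most 16 \<eta> = e.\<close>
  define k where "k z = g z + \<eta>" for z
  have kt: "trig_poly k"
    unfolding k_def by (intro trig_poly_add trig_poly_const trig_poly_real_polynomial_function g)
  have gc: "continuous_on UNIV g"
    using g(1) by (simp add: continuous_on_polymonial_function real_polynomial_function_eq)
  then have kc: "continuous_on UNIV k" unfolding k_def by (intro continuous_intros)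
  have hk: "h z \<le> k z" "k z \<le> h z + 2 * \<eta>" if "norm z = 1" for z
    using g(2)[of z] that by (simp_all add: k_def abs_less_iff)
  have hp: "h z > 0" for z using \<delta> by (meson less_le_trans)
  have kp: "k z > 0" if "norm z = 1" for z
    using hk(1)[OF that] hp[of z] by linarith
  have mono: "(LINT z|L. p z) \<le> (LINT z|L. q z)"
    if "circle_measure L" "integrable L p" "integrable L q" "\<And>z. norm z = 1 \<Longrightarrow> p z \<le> q z"
    for L and p q :: "complex \<Rightarrow> real"
    using that circle_measure.AE_norm[OF that(1)] by (intro integral_mono_AE) (auto elim!: eventually_mono)
  have hm: "h \<in> borel_measurable borel" "k \<in> borel_measurable borel"
    using h kc by (auto intro: borel_measurable_continuous_onI)
  note [measurable] = hm
  have "compact (k ` sphere 0 1)"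
    by (intro compact_continuous_image continuous_on_subset[OF kc]) auto
  then obtain B where "\<And>z. z \<in> sphere 0 1 \<Longrightarrow> norm (k z) \<le> B"
    by (meson compact_imp_bounded bounded_iff imageI)
  then have B: "\<bar>k z\<bar> \<le> B" if "norm z = 1" for z using that by simp
  have lnb: "\<bar>ln x\<bar> \<le> \<bar>ln \<delta>\<bar> + \<bar>ln B\<bar>" if "\<delta> \<le> x" "x \<le> B" for x
  proof -
    have "ln \<delta> \<le> ln x" "ln x \<le> ln B" using that \<delta>(1) by simp_all
    then show ?thesis by linarith
  qed
  have int: "integrable circle_lebesgue (\<lambda>z. cos_weight z * ln (p z))"
    if [measurable]: "p \<in> borel_measurable borel" and p: "\<And>z. norm z = 1 \<Longrightarrow> \<delta> \<le> p z \<and> p z \<le> B" for p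
  proof (rule integrable_bounded_circle[OF circle_measure_circle_lebesgue, of _ "8 * (\<bar>ln \<delta>\<bar> + \<bar>ln B\<bar>)"])
    fix z :: complex assume z: "norm z = 1"
    show "\<bar>cos_weight z * ln (p z)\<bar> \<le> 8 * (\<bar>ln \<delta>\<bar> + \<bar>ln B\<bar>)"
      unfolding abs_mult using cos_weight_bounds[OF z] p[OF z] lnb[of "p z"]
      by (intro mult_mono) auto
  qed measurable
  have "(LINT z|circle_lebesgue. cos_weight z * ln (h z)) \<le> (LINT z|circle_lebesgue. cos_weight z * ln (k z))"
  proof (rule mono[OF circle_measure_circle_lebesgue])
    show "integrable circle_lebesgue (\<lambda>z. cos_weight z * ln (h z))"
      using \<delta>(2) hk B by (intro int hm) (meson abs_le_D1 order.trans)
    show "integrable circle_lebesgue (\<lambda>z. cos_weight z * ln (k z))"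
      using \<delta>(2) hk B by (intro int hm) (meson abs_le_D1 order.trans)
    show "cos_weight z * ln (h z) \<le> cos_weight z * ln (k z)" if "norm z = 1" for z
      using hk(1)[OF that] hp[of z] cos_weight_bounds[OF that] by (intro mult_left_mono) auto
  qed
  then have "C + (LINT z|circle_lebesgue. cos_weight z * ln (h z)) \<le> (LINT z|M. cos_weight z * k z)"
    using entropy_bound_trig_poly[OF kt kc kp] by linarith
  also have "\<dots> \<le> (LINT z|M. cos_weight z * h z + 16 * \<eta>)"
  proof (rule mono[OF circle_measure_axioms])
    show "integrable M (\<lambda>z. cos_weight z * k z)" "integrable M (\<lambda>z. cos_weight z * h z + 16 * \<eta>)"
      by (intro integrable_continuous continuous_intros h kc)+
    fix z :: complex assume z: "norm z = 1"
    have "cos_weight z * k z \<le> cos_weight z * (h z + 2 * \<eta>)"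
      using hk(2)[OF z] cos_weight_bounds[OF z] by (intro mult_left_mono) auto
    also have "\<dots> \<le> cos_weight z * h z + 16 * \<eta>"
      using mult_right_mono[OF cos_weight_bounds(2)[OF z], of "2 * \<eta>"] \<eta> by (simp add: algebra_simps)
    finally show "cos_weight z * k z \<le> cos_weight z * h z + 16 * \<eta>" .
  qed
  also have "\<dots> = (LINT z|M. cos_weight z * h z) + e"
    using mass by (subst Bochner_Integration.integral_add)
      (auto intro!: integrable_continuous continuous_intros h simp: \<eta>_def)
  finally show "C + (LINT z|circle_lebesgue. cos_weight z * ln (h z)) \<le> (LINT z|M. cos_weight z * h z) + e" .
qed

lemma entropy_bound_measurable:
  assumes [measurable]: "h \<in> borel_measurable borel"
    and \<delta>: "\<delta> > 0" "\<And>z. h z \<ge> \<delta>" and B: "\<And>z. h z \<le> B"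
  shows "C + (LINT z|circle_lebesgue. cos_weight z * ln (h z)) \<le> (LINT z|M. cos_weight z * h z)"
proof (rule field_le_epsilon)
  fix e :: real assume "e > 0"
  \<comment> \<open>Above \<delta> the logarithm has Lipschitz constant 1/\<delta>, which with the
    weight gives 8/\<delta>; the linear term on the right contributes another 8.\<close>
  define \<eta> where "\<eta> = e / (8 / \<delta> + 8)"
  have pos: "8 / \<delta> + 8 > 0" using \<delta>(1) by (simp add: add_pos_pos)
  then have \<eta>: "\<eta> > 0" using \<open>e > 0\<close> by (simp add: \<eta>_def)
  have "(8 / \<delta> + 8) * \<eta> = e" using pos by (simp add: \<eta>_def)
  then have e: "e = 8 / \<delta> * \<eta> + 8 * \<eta>" by (simp only: distrib_right)
  let ?S = "sum_measure circle_lebesgue M"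
  have fS: "finite_measure ?S"
    by (intro finite_measure_sum_measure circle.finite_measure_axioms finite_measure_axioms) simp
  interpret S: finite_measure ?S by fact
  have "norm (h z) \<le> B" for z using \<delta>(1) \<delta>(2)[of z] B[of z] by simp
  then have "integrable ?S h"
    by (intro S.integrable_const_bound[of _ B]) (auto simp: measurable_cong_sets[OF sets_sum_measure refl])
  then obtain g0 where g0: "continuous_on UNIV g0" "(\<integral>\<^sup>+z. ennreal \<bar>h z - g0 z\<bar> \<partial>?S) < ennreal \<eta>"
    using continuous_dense_L1[OF fS _ \<open>integrable ?S h\<close>] \<eta> by auto
  \<comment> \<open>Clamping to an interval that contains the range of h keeps the continuous
    approximant bounded and away from 0 without increasing its distance from h.\<close>
  define g where "g z = max \<delta> (min (g0 z) B)" for z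
  have gc: "continuous_on UNIV g" unfolding g_def by (intro continuous_intros g0)
  have \<delta>B: "\<delta> \<le> B" using \<delta>(2)[of 0] B[of 0] by linarith
  have gb: "\<delta> \<le> g z" "g z \<le> B" for z using \<delta>B by (auto simp: g_def)
  have gh: "\<bar>h z - g z\<bar> \<le> \<bar>h z - g0 z\<bar>" for z
    using \<delta>(2)[of z] B[of z] by (auto simp: g_def max_def min_def)
  have [measurable]: "g \<in> borel_measurable borel" using gc by (rule borel_measurable_continuous_onI)
  have close: "integrable L (\<lambda>z. \<bar>h z - g z\<bar>)" "(LINT z|L. \<bar>h z - g z\<bar>) \<le> \<eta>"
    if L: "circle_measure L" "L \<le> ?S" for L
  proof -
    interpret L: circle_measure L by fact
    show i: "integrable L (\<lambda>z. \<bar>h z - g z\<bar>)"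
    proof (rule integrable_bounded_circle[OF L(1), of _ "B - \<delta>"])
      show "\<bar>\<bar>h z - g z\<bar>\<bar> \<le> B - \<delta>" for z
        using \<delta>(2)[of z] B[of z] gb[of z] by simp
    qed measurable
    have "ennreal (LINT z|L. \<bar>h z - g z\<bar>) = (\<integral>\<^sup>+z. ennreal \<bar>h z - g z\<bar> \<partial>L)"
      using i by (subst nn_integral_eq_integral) auto
    also have "\<dots> \<le> (\<integral>\<^sup>+z. ennreal \<bar>h z - g0 z\<bar> \<partial>L)"
      by (intro nn_integral_mono ennreal_leI gh)
    also have "\<dots> \<le> (\<integral>\<^sup>+z. ennreal \<bar>h z - g0 z\<bar> \<partial>?S)"
      by (rule nn_integral_mono_measure[OF _ L(2)]) simp
    also have "\<dots> \<le> ennreal \<eta>" using g0(2) by simp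
    finally show "(LINT z|L. \<bar>h z - g z\<bar>) \<le> \<eta>" using \<eta> by (simp add: ennreal_le_iff)
  qed
  have le: "circle_lebesgue \<le> ?S" "M \<le> ?S" by (intro le_sum_measure; simp)+
  note close1 = close[OF circle_measure_circle_lebesgue le(1)]
  note close2 = close[OF circle_measure_axioms le(2)]
  have mono: "(LINT z|L. p z) \<le> (LINT z|L. q z) + K * (LINT z|L. \<bar>h z - g z\<bar>)"
    if "circle_measure L" "integrable L p" "integrable L q" "integrable L (\<lambda>z. \<bar>h z - g z\<bar>)"
      "\<And>z. norm z = 1 \<Longrightarrow> p z \<le> q z + K * \<bar>h z - g z\<bar>"
    for L and p q :: "complex \<Rightarrow> real" and K
  proof -
    have "(LINT z|L. p z) \<le> (LINT z|L. q z + K * \<bar>h z - g z\<bar>)"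
      using that circle_measure.AE_norm[OF that(1)] by (intro integral_mono_AE) (auto elim!: eventually_mono)
    then show ?thesis using that by simp
  qed
  have lnb: "\<bar>ln x\<bar> \<le> \<bar>ln \<delta>\<bar> + \<bar>ln B\<bar>" if "\<delta> \<le> x" "x \<le> B" for x
  proof -
    have "ln \<delta> \<le> ln x" "ln x \<le> ln B" using that \<delta>(1) by simp_all
    then show ?thesis by linarith
  qed
  have int: "integrable circle_lebesgue (\<lambda>z. cos_weight z * ln (p z))"
    if [measurable]: "p \<in> borel_measurable borel" and p: "\<And>z. \<delta> \<le> p z \<and> p z \<le> B" for p
  proof (rule integrable_bounded_circle[OF circle_measure_circle_lebesgue, of _ "8 * (\<bar>ln \<delta>\<bar> + \<bar>ln B\<bar>)"])
    fix z :: complex assume z: "norm z = 1"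
    show "\<bar>cos_weight z * ln (p z)\<bar> \<le> 8 * (\<bar>ln \<delta>\<bar> + \<bar>ln B\<bar>)"
      unfolding abs_mult using cos_weight_bounds[OF z] p[of z] lnb[of "p z"]
      by (intro mult_mono) auto
  qed measurable
  have int': "integrable M (\<lambda>z. cos_weight z * p z)"
    if [measurable]: "p \<in> borel_measurable borel" and p: "\<And>z. \<delta> \<le> p z \<and> p z \<le> B" for p
  proof (rule integrable_bounded_circle[OF circle_measure_axioms, of _ "8 * B"])
    fix z :: complex assume z: "norm z = 1"
    show "\<bar>cos_weight z * p z\<bar> \<le> 8 * B"
      unfolding abs_mult using cos_weight_bounds[OF z] p[of z] \<delta>(1)
      by (intro mult_mono) auto
  qed measurable
  have "(LINT z|circle_lebesgue. cos_weight z * ln (h z))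
      \<le> (LINT z|circle_lebesgue. cos_weight z * ln (g z)) + (8 / \<delta>) * (LINT z|circle_lebesgue. \<bar>h z - g z\<bar>)"
  proof (rule mono[OF circle_measure_circle_lebesgue _ _ close1(1)])
    show "integrable circle_lebesgue (\<lambda>z. cos_weight z * ln (h z))"
      "integrable circle_lebesgue (\<lambda>z. cos_weight z * ln (g z))"
      using \<delta>(2) B gb by (intro int; simp)+
    fix z :: complex assume z: "norm z = 1"
    have gz: "g z > 0" "h z > 0" using gb(1)[of z] \<delta>(1) \<delta>(2)[of z] by linarith+
    have "ln (h z) - ln (g z) = ln (h z / g z)" using gz by (simp add: ln_div)
    also have "\<dots> \<le> h z / g z - 1" using gz by (intro ln_le_minus_one) simp
    also have "\<dots> = (h z - g z) / g z" using gz by (simp add: field_simps)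
    also have "\<dots> \<le> \<bar>h z - g z\<bar> / \<delta>"
      using gz gb(1)[of z] \<delta>(1) by (intro frac_le) auto
    finally have "cos_weight z * (ln (h z) - ln (g z)) \<le> cos_weight z * (\<bar>h z - g z\<bar> / \<delta>)"
      using cos_weight_bounds[OF z] by (intro mult_left_mono) auto
    also have "\<dots> \<le> 8 * (\<bar>h z - g z\<bar> / \<delta>)"
      using cos_weight_bounds[OF z] \<delta>(1) by (intro mult_right_mono) auto
    finally show "cos_weight z * ln (h z) \<le> cos_weight z * ln (g z) + 8 / \<delta> * \<bar>h z - g z\<bar>"
      by (simp add: algebra_simps)
  qed
  also have "\<dots> \<le> (LINT z|circle_lebesgue. cos_weight z * ln (g z)) + 8 / \<delta> * \<eta>"
    using close1(2) \<delta>(1) by (intro add_left_mono mult_left_mono) auto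
  finally have 1: "(LINT z|circle_lebesgue. cos_weight z * ln (h z))
      \<le> (LINT z|circle_lebesgue. cos_weight z * ln (g z)) + 8 / \<delta> * \<eta>" .
  have "(LINT z|M. cos_weight z * g z) \<le> (LINT z|M. cos_weight z * h z) + 8 * (LINT z|M. \<bar>h z - g z\<bar>)"
  proof (rule mono[OF circle_measure_axioms _ _ close2(1)])
    show "integrable M (\<lambda>z. cos_weight z * h z)" "integrable M (\<lambda>z. cos_weight z * g z)"
      using \<delta>(2) B gb by (intro int'; simp)+
    fix z :: complex assume z: "norm z = 1"
    have "cos_weight z * (g z - h z) \<le> 8 * \<bar>h z - g z\<bar>"
      using cos_weight_bounds[OF z] mult_mono[of "cos_weight z" 8 "g z - h z" "\<bar>h z - g z\<bar>"]
        mult_left_mono[of "g z - h z" "\<bar>h z - g z\<bar>" "cos_weight z"]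
        mult_right_mono[of "cos_weight z" 8 "\<bar>h z - g z\<bar>"] by linarith
    then show "cos_weight z * g z \<le> cos_weight z * h z + 8 * \<bar>h z - g z\<bar>"
      by (simp add: algebra_simps)
  qed
  then have 2: "(LINT z|M. cos_weight z * g z) \<le> (LINT z|M. cos_weight z * h z) + 8 * \<eta>"
    using close2(2) by linarith
  show "C + (LINT z|circle_lebesgue. cos_weight z * ln (h z)) \<le> (LINT z|M. cos_weight z * h z) + e"
    using 1 2 entropy_bound_continuous[OF gc \<delta>(1) gb(1)] unfolding e by linarith
qed

end

end

section \<open>The logarithmic integral\<close>

text \<open>Serves to move w, a function of the angle, to the circle. \<open>Arg2pi\<close> is
  continuous off the nonnegative real axis and vanishes on it.\<close>

lemma Arg2pi_measurable [measurable]: "Arg2pi \<in> borel_measurable borel"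
proof -
  have "(\<lambda>z. if z \<in> \<real>\<^sub>\<ge>\<^sub>0 then 0 else Arg2pi z) \<in> borel_measurable borel"
  proof (rule borel_measurable_continuous_on_if)
    show "continuous_on (- \<real>\<^sub>\<ge>\<^sub>0) Arg2pi"
      by (intro continuous_at_imp_continuous_on ballI continuous_at_Arg2pi) auto
  qed auto
  moreover have "(\<lambda>z. if z \<in> \<real>\<^sub>\<ge>\<^sub>0 then 0 else Arg2pi z) = Arg2pi"
    using Arg2pi_eq_0 by (auto simp: fun_eq_iff complex_nonneg_Reals_iff complex_is_Real_iff)
  ultimately show ?thesis by simp
qed

lemma Arg2pi_cis: "0 \<le> \<theta> \<Longrightarrow> \<theta> < 2*pi \<Longrightarrow> Arg2pi (cis \<theta>) = \<theta>"
  by (rule Arg2pi_unique[of 1]) (simp_all add: cis_conv_exp mult.commute)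

text \<open>The two endpoints share the point z = 1; off this null set \<open>Arg2pi\<close> inverts
  \<open>cis\<close>.\<close>

lemma AE_angle_measure: "AE \<theta> in angle_measure. 0 < \<theta> \<and> \<theta> < 2*pi"
proof -
  have "AE \<theta> in lborel. \<theta> \<noteq> 0 \<and> \<theta> \<noteq> 2*pi"
    using AE_lborel_singleton[of 0] AE_lborel_singleton[of "2*pi"] by eventually_elim simp
  then have *: "AE \<theta> in lborel. 0 < ennreal (indicator {0..2*pi} \<theta> / (2*pi)) \<longrightarrow> 0 < \<theta> \<and> \<theta> < 2*pi"
    by eventually_elim (auto simp: indicator_def split: if_splits)
  show ?thesis
    unfolding angle_measure_density by (subst AE_density) (use * in simp_all)
qed

lemma cos_weight_cis: "cos_weight (cis \<theta>) = (1 - cos \<theta>) ^ 3"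
  by (simp add: cos_weight_def)

lemma cos_weight_cis_bounds: "0 \<le> (1 - cos \<theta>) ^ 3" "(1 - cos \<theta>) ^ 3 \<le> 8" for \<theta> :: real
  using cos_weight_bounds[of "cis \<theta>"] by (simp_all add: cos_weight_cis)

lemma elog_mult_pos: "x > 0 \<Longrightarrow> ereal f * elog x = ereal (f * ln x)"
  by (simp add: elog_def)

text \<open>Bounds the positive part of the integrand by an integrable function, through log x <= x
  - 1. For x <= 0 the product is -\<infinity> or, when f = 0, equal to 0.\<close>

lemma e2ennreal_elog_le:
  assumes "0 \<le> f" "f \<le> 8"
  shows "e2ennreal (ereal f * elog x) \<le> ennreal (8 * x)"
proof (cases "x > 0")
  case True
  have "f * ln x \<le> 8 * x"
  proof (cases "ln x \<ge> 0")
    case True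
    have "f * ln x \<le> 8 * ln x" using assms True by (intro mult_right_mono) auto
    also have "\<dots> \<le> 8 * x" using ln_le_minus_one[OF \<open>x > 0\<close>] by simp
    finally show ?thesis .
  next
    case False
    then have "f * ln x \<le> 0" using assms by (simp add: mult_nonneg_nonpos)
    then show ?thesis using True by linarith
  qed
  then show ?thesis unfolding elog_mult_pos[OF True] e2ennreal_ereal by (rule ennreal_leI)
next
  case False
  then have "ereal f * elog x \<le> 0"
    using assms by (simp add: elog_def)
  then have "e2ennreal (ereal f * elog x) = 0" by (rule e2ennreal_neg)
  then show ?thesis by simp
qed

lemma elog_measurable [measurable]: "elog \<in> borel_measurable borel"
  unfolding elog_def by measurable

section \<open>Bounded entropies and the integrability of log w\<close>

locale opuc_decomposition = opuc \<alpha> M for \<alpha> M +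
  fixes w :: "real \<Rightarrow> real" and Ms :: "complex measure"
  assumes dec: "circle_lebesgue_decomposition M w Ms"
begin

abbreviation W :: "complex \<Rightarrow> real" where "W z \<equiv> w (Arg2pi z)"

definition Mac :: "complex measure" where
  "Mac = distr (density angle_measure (\<lambda>\<theta>. ennreal (w \<theta>))) borel cis"

lemma w_measurable [measurable]: "w \<in> borel_measurable borel"
  using dec by (simp add: circle_lebesgue_decomposition_def)

lemma AE_w: "AE \<theta> in angle_measure. 0 < \<theta> \<and> \<theta> < 2*pi \<and> 0 \<le> w \<theta> \<and> W (cis \<theta>) = w \<theta>"
  using AE_angle_measure
proof eventually_elim
  case (elim \<theta>)
  then show ?case
    using dec by (auto simp: circle_lebesgue_decomposition_def Arg2pi_cis)
qed

lemma sets_Mac [simp, measurable_cong]: "sets Mac = sets borel"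
  by (simp add: Mac_def)

lemma Mac_le: "Mac \<le> M"
proof (subst le_measure)
  show "\<forall>A\<in>sets Mac. emeasure Mac A \<le> emeasure M A"
    using dec by (simp add: circle_lebesgue_decomposition_def Mac_def)
qed simp

lemma nn_integral_Mac:
  assumes [measurable]: "g \<in> borel_measurable borel"
  shows "(\<integral>\<^sup>+z. g z \<partial>Mac) = (\<integral>\<^sup>+\<theta>. ennreal (w \<theta>) * g (cis \<theta>) \<partial>angle_measure)"
  unfolding Mac_def by (simp add: nn_integral_distr nn_integral_density)

lemma nn_integral_w_le:
  assumes [measurable]: "g \<in> borel_measurable borel"
  shows "(\<integral>\<^sup>+\<theta>. ennreal (w \<theta>) * g (cis \<theta>) \<partial>angle_measure) \<le> (\<integral>\<^sup>+z. g z \<partial>M)"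
  unfolding nn_integral_Mac[OF assms, symmetric]
  by (rule nn_integral_mono_measure) (simp_all add: Mac_le)

lemma emeasure_M: "emeasure M UNIV = 1"
  using mass by (simp add: emeasure_eq_measure)

lemma nn_integral_w: "(\<integral>\<^sup>+\<theta>. ennreal (w \<theta>) \<partial>angle_measure) \<le> 1"
  using nn_integral_w_le[of "\<lambda>_. 1"] emeasure_M by simp

lemma nn_integral_8w: "(\<integral>\<^sup>+\<theta>. ennreal (8 * w \<theta>) \<partial>angle_measure) \<le> 8"
proof -
  have "(\<integral>\<^sup>+\<theta>. ennreal (8 * w \<theta>) \<partial>angle_measure) = (\<integral>\<^sup>+\<theta>. 8 * ennreal (w \<theta>) \<partial>angle_measure)"
    by (intro nn_integral_cong) (simp add: ennreal_mult')
  also have "\<dots> = 8 * (\<integral>\<^sup>+\<theta>. ennreal (w \<theta>) \<partial>angle_measure)"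
    by (rule nn_integral_cmult) measurable
  also have "\<dots> \<le> 8 * 1" by (intro mult_left_mono nn_integral_w) simp
  finally show ?thesis by simp
qed

definition neg_part :: ennreal where
  "neg_part = (\<integral>\<^sup>+\<theta>. e2ennreal (- (ereal ((1 - cos \<theta>) ^ 3) * elog (w \<theta>))) \<partial>angle_measure)"

lemma ext_integral_iff:
  "ext_integral angle_measure (\<lambda>\<theta>. ereal ((1 - cos \<theta>) ^ 3) * elog (w \<theta>)) > - \<infinity> \<longleftrightarrow> neg_part < \<infinity>"
proof -
  define pos where "pos = (\<integral>\<^sup>+\<theta>. e2ennreal (ereal ((1 - cos \<theta>) ^ 3) * elog (w \<theta>)) \<partial>angle_measure)"
  have "pos \<le> (\<integral>\<^sup>+\<theta>. ennreal (8 * w \<theta>) \<partial>angle_measure)"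
    unfolding pos_def by (intro nn_integral_mono e2ennreal_elog_le cos_weight_cis_bounds)
  also have "\<dots> < \<infinity>" using nn_integral_8w by (rule order.strict_trans1) simp
  finally have "pos < \<infinity>" .
  then have "enn2ereal pos - enn2ereal neg_part > - \<infinity> \<longleftrightarrow> neg_part < \<infinity>"
    by (cases pos; cases neg_part) (simp_all add: enn2ereal_ennreal)
  then show ?thesis by (simp add: ext_integral_def pos_def neg_part_def)
qed

text \<open>On the circle 1/w_n is the squared modulus of the orthonormal polynomial; discarding the
  singular part of \<mu> leaves an inequality.\<close>

lemma integral_inverse_bs_weight:
  "(\<integral>\<^sup>+\<theta>. ennreal (w \<theta>) * ennreal (1 / bs_weight n (cis \<theta>)) \<partial>angle_measure) \<le> 1"
proof -
  have "(\<integral>\<^sup>+\<theta>. ennreal (w \<theta>) * ennreal (1 / bs_weight n (cis \<theta>)) \<partial>angle_measure)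
      \<le> (\<integral>\<^sup>+z. ennreal (1 / bs_weight n z) \<partial>M)"
    by (rule nn_integral_w_le) measurable
  also have "\<dots> = (\<integral>\<^sup>+z. ennreal ((norm (poly (P n) z))\<^sup>2 / norm_prod n) \<partial>M)"
    using AE_norm by (intro nn_integral_cong_AE)
      (auto elim!: eventually_mono simp: bs_weight_def Q_circle norm_mult norm_power)
  also have "\<dots> = ennreal (LINT z|M. (norm (poly (P n) z))\<^sup>2 / norm_prod n)"
    using norm_prod_pos[of n] by (intro nn_integral_eq_integral integrable_continuous continuous_intros) auto
  also have "(LINT z|M. (norm (poly (P n) z))\<^sup>2 / norm_prod n) = 1"
  proof -
    have "complex_of_real (LINT z|M. (norm (poly (P n) z))\<^sup>2) = of_real (norm_prod n)"
      using orth_norm_square[OF orth] orth_norm[OF orth] mass by simp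
    then show ?thesis using norm_prod_pos[of n] by (simp only: of_real_eq_iff) simp
  qed
  finally show ?thesis by simp
qed

lemma bs_entropy_bounded_below:
  assumes fin: "neg_part < \<infinity>"
  shows "\<exists>C. \<forall>n. bs_entropy n \<ge> C"
proof -
  let ?f = "\<lambda>\<theta>. (1 - cos \<theta>) ^ 3 :: real"
  define p where "p \<theta> = ?f \<theta> * ln (w \<theta>)" for \<theta>
  have [measurable]: "p \<in> borel_measurable borel" unfolding p_def by measurable
  \<comment> \<open>Where w <= 0 the integrand of \<open>neg_part\<close> is \<infinity> unless cos
    \<theta> = 1, which is excluded on the open interval; finiteness therefore gives w > 0 almost
    everywhere.\<close>
  have "AE \<theta> in angle_measure. e2ennreal (- (ereal (?f \<theta>) * elog (w \<theta>))) \<noteq> \<infinity>"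
    using fin unfolding neg_part_def by (intro nn_integral_PInf_AE) auto
  then have wpos: "AE \<theta> in angle_measure. 0 < w \<theta>"
    using AE_w
  proof eventually_elim
    case (elim \<theta>)
    have "cos \<theta> \<noteq> 1"
    proof
      assume "cos \<theta> = 1"
      then obtain k :: int where k: "\<theta> = of_int k * 2 * pi" using cos_one_2pi_int by blast
      then have "0 < of_int k * (2 * pi)" "of_int k * (2 * pi) < 1 * (2 * pi)" using elim by (simp_all add: mult_ac)
      then have "(0::real) < of_int k" "(of_int k :: real) < 1"
        by (simp_all add: zero_less_mult_iff)
      then show False by simp
    qed
    then have "?f \<theta> > 0" using cos_le_one[of \<theta>] by (intro zero_less_power) linarith
    then show ?case
      using elim by (cases "w \<theta> > 0") (auto simp: elog_def)
  qed
  have int: "integrable angle_measure p"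
  proof (rule integrableI_bounded)
    have "(\<integral>\<^sup>+\<theta>. ennreal (norm (p \<theta>)) \<partial>angle_measure)
        \<le> (\<integral>\<^sup>+\<theta>. ennreal (8 * w \<theta>) + e2ennreal (- (ereal (?f \<theta>) * elog (w \<theta>))) \<partial>angle_measure)"
    proof (intro nn_integral_mono_AE)
      show "AE \<theta> in angle_measure. ennreal (norm (p \<theta>)) \<le> ennreal (8 * w \<theta>) + e2ennreal (- (ereal (?f \<theta>) * elog (w \<theta>)))"
        using wpos
      proof eventually_elim
        case (elim \<theta>)
        show ?case
        proof (cases "p \<theta> \<ge> 0")
          case True
          have "ennreal (norm (p \<theta>)) \<le> ennreal (8 * w \<theta>)"
            using e2ennreal_elog_le[OF cos_weight_cis_bounds, of \<theta> "w \<theta>"] True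
            unfolding elog_mult_pos[OF elim] by (simp add: p_def)
          then show ?thesis by (rule order.trans) simp
        next
          case False
          then have "ennreal (norm (p \<theta>)) = e2ennreal (- (ereal (?f \<theta>) * elog (w \<theta>)))"
            unfolding elog_mult_pos[OF elim] by (simp add: p_def)
          then show ?thesis by simp
        qed
      qed
    qed
    also have "\<dots> = (\<integral>\<^sup>+\<theta>. ennreal (8 * w \<theta>) \<partial>angle_measure) + neg_part"
      unfolding neg_part_def by (rule nn_integral_add) measurable
    also have "\<dots> < \<infinity>" using fin nn_integral_8w
      by (simp add: ennreal_add_less_top) (meson ennreal_numeral_less_top order.strict_trans1)
    finally show "(\<integral>\<^sup>+\<theta>. ennreal (norm (p \<theta>)) \<partial>angle_measure) < \<infinity>" .
  qed simp
  \<comment> \<open>With q = w / w_n one has log w <= q + log w_n; the weight is at most 8 and q has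
    integral at most 1, whence the constant 8.\<close>
  have "bs_entropy n \<ge> (LINT \<theta>|angle_measure. p \<theta>) - 8" for n
  proof -
    let ?b = "\<lambda>\<theta>. bs_weight n (cis \<theta>)"
    define q where "q \<theta> = w \<theta> / ?b \<theta>" for \<theta>
    have [measurable]: "q \<in> borel_measurable borel" unfolding q_def by measurable
    have b: "?b \<theta> > 0" for \<theta> by (rule bs_weight_pos) simp
    have q0: "AE \<theta> in angle_measure. 0 \<le> q \<theta>"
      using AE_w
    proof eventually_elim
      case (elim \<theta>)
      then show ?case using b[of \<theta>] by (simp add: q_def)
    qed
    have "(\<integral>\<^sup>+\<theta>. ennreal (q \<theta>) \<partial>angle_measure)
        = (\<integral>\<^sup>+\<theta>. ennreal (w \<theta>) * ennreal (1 / ?b \<theta>) \<partial>angle_measure)"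
    proof (intro nn_integral_cong)
      show "ennreal (q \<theta>) = ennreal (w \<theta>) * ennreal (1 / ?b \<theta>)" for \<theta>
        using b[of \<theta>] by (subst ennreal_mult''[symmetric]) (simp_all add: q_def)
    qed
    then have qle: "(\<integral>\<^sup>+\<theta>. ennreal (q \<theta>) \<partial>angle_measure) \<le> 1"
      using integral_inverse_bs_weight[of n] by simp
    have qi: "integrable angle_measure q"
      by (rule integrableI_nonneg) (use q0 qle in \<open>auto intro: order.strict_trans1\<close>)
    have q1: "(LINT \<theta>|angle_measure. q \<theta>) \<le> 1"
      using nn_integral_eq_integral[OF qi q0] qle by simp
    have bi: "integrable angle_measure (\<lambda>\<theta>. ?f \<theta> * ln (?b \<theta>))"
      by (intro angle_continuous continuous_intros ln_bs_weight_continuous)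
    have "(LINT \<theta>|angle_measure. p \<theta>) \<le> (LINT \<theta>|angle_measure. 8 * q \<theta> + ?f \<theta> * ln (?b \<theta>))"
    proof (intro integral_mono_AE int Bochner_Integration.integrable_add integrable_mult_right qi bi)
      show "AE \<theta> in angle_measure. p \<theta> \<le> 8 * q \<theta> + ?f \<theta> * ln (?b \<theta>)"
        using wpos
      proof eventually_elim
        case (elim \<theta>)
        have qp: "q \<theta> > 0" using elim b[of \<theta>] by (simp add: q_def)
        have "ln (w \<theta>) = ln (q \<theta>) + ln (?b \<theta>)"
          using elim b[of \<theta>] qp by (simp add: q_def ln_div)
        then have "ln (w \<theta>) \<le> q \<theta> + ln (?b \<theta>)" using ln_le_minus_one[OF qp] by linarith
        then have "p \<theta> \<le> ?f \<theta> * (q \<theta> + ln (?b \<theta>))"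
          unfolding p_def by (rule mult_left_mono) (rule cos_weight_cis_bounds)
        also have "\<dots> \<le> 8 * q \<theta> + ?f \<theta> * ln (?b \<theta>)"
          using mult_right_mono[OF cos_weight_cis_bounds(2)[of \<theta>], of "q \<theta>"] qp by (simp add: distrib_left)
        finally show ?case .
      qed
    qed
    also have "\<dots> = 8 * (LINT \<theta>|angle_measure. q \<theta>) + bs_entropy n"
      unfolding bs_entropy_def using qi bi by simp
    finally show ?thesis using q1 by linarith
  qed
  then show ?thesis by blast
qed

text \<open>The set A is the one given by mutual singularity: it is Lebesgue null, and
  \<open>Ms\<close> vanishes outside it.\<close>

lemma singular_set:
  obtains A where "A \<in> sets borel" "AE \<theta> in angle_measure. cis \<theta> \<notin> A"
    "\<And>B. B \<in> sets borel \<Longrightarrow> emeasure M (B - A) = emeasure Mac (B - A)"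
proof -
  have "mutually_singular circle_lebesgue Ms" and Ms: "sets Ms = sets borel"
    using dec by (simp_all add: circle_lebesgue_decomposition_def circle_lebesgue_def)
  then obtain A where A: "A \<in> sets borel" "emeasure circle_lebesgue A = 0" "emeasure Ms (space Ms - A) = 0"
    by (auto simp: mutually_singular_def)
  have "AE z in circle_lebesgue. z \<notin> A"
    using A(1,2) by (intro AE_not_in) (simp add: null_sets_def)
  then have "AE \<theta> in angle_measure. cis \<theta> \<notin> A"
    unfolding circle_lebesgue_def using A(1) by (subst (asm) AE_distr_iff) auto
  moreover have "emeasure M (B - A) = emeasure Mac (B - A)" if B: "B \<in> sets borel" for B
  proof -
    have "space Ms = UNIV" using sets_eq_imp_space_eq[OF Ms] by simp
    then have "emeasure Ms (B - A) \<le> emeasure Ms (space Ms - A)"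
      using A(1) Ms by (intro emeasure_mono) auto
    then have "emeasure Ms (B - A) = 0" using A(3) by simp
    moreover have "B - A \<in> sets borel" using A(1) B by simp
    ultimately show ?thesis
      using dec by (simp add: circle_lebesgue_decomposition_def Mac_def)
  qed
  ultimately show ?thesis using that A(1) by blast
qed

text \<open>The choice h = 1/w would turn the variational inequality into a bound for the integral
  of -f log w, with f the weight. The truncations \<open>m k\<close> make it admissible, and Fatou's
  lemma removes them, as the bounds are uniform in k.\<close>

lemma neg_part_finite:
  assumes C: "\<And>n. bs_entropy n \<ge> C"
  shows "neg_part < \<infinity>"
proof -
  let ?f = "\<lambda>\<theta>. (1 - cos \<theta>) ^ 3 :: real"
  obtain A where A [measurable]: "A \<in> sets borel" and AE_A: "AE \<theta> in angle_measure. cis \<theta> \<notin> A"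
    and MA: "\<And>B. B \<in> sets borel \<Longrightarrow> emeasure M (B - A) = emeasure Mac (B - A)"
    using singular_set by blast
  \<comment> \<open>Carries integrals over the complement of A from \<mu> to its absolutely
    continuous part.\<close>
  have dens: "density M (indicator (- A)) = density Mac (indicator (- A))"
  proof (rule measure_eqI)
    fix B assume "B \<in> sets (density M (indicator (- A)))"
    then have B: "B \<in> sets borel" by simp
    have "emeasure L (- A \<inter> B) = (\<integral>\<^sup>+z. indicator (- A) z * indicator B z \<partial>L)" if "sets L = sets borel" for L :: "complex measure"
      using B A that by (simp add: indicator_inter_arith[symmetric])
    moreover have "- A \<inter> B = B - A" by auto
    ultimately show "emeasure (density M (indicator (- A))) B = emeasure (density Mac (indicator (- A))) B"
      using B MA[OF B] by (simp add: emeasure_density)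
  qed simp
  define \<epsilon> where "\<epsilon> k = 1 / real (Suc k)" for k
  have \<epsilon>: "0 < \<epsilon> k" "\<epsilon> k \<le> 1" for k by (simp_all add: \<epsilon>_def)
  \<comment> \<open>The lower cutoff bounds 1 / \<open>m k\<close>; the upper cutoff 1 makes the
    negated logarithm nonnegative and isolates the negative part of log w.\<close>
  define m where "m k x = max (\<epsilon> k) (min x 1)" for k and x :: real
  have m: "\<epsilon> k \<le> m k x" "m k x \<le> 1" for k x using \<epsilon>[of k] by (auto simp: m_def)
  then have mp: "0 < m k x" for k x using \<epsilon>(1)[of k] less_le_trans by blast
  \<comment> \<open>24 = 8 + 8 + 8: the first 8 covers A, where h = 1, and off A the estimate w /
    \<open>m k w\<close> <= 1 + w gives 8 for the constant and 8 for the mass of w.\<close>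
  have bound: "(\<integral>\<^sup>+\<theta>. ennreal (?f \<theta> * - ln (m k (w \<theta>))) \<partial>angle_measure) \<le> ennreal (24 - C)" for k
  proof -
    \<comment> \<open>The singular part of the measure lives on \<open>A\<close>, where \<open>h\<close> must stay bounded as \<open>k\<close> grows.\<close>
    define h where "h z = (if z \<in> A then 1 else 1 / m k (W z))" for z
    have hm [measurable]: "h \<in> borel_measurable borel"
      unfolding h_def m_def by measurable
    have h1: "1 \<le> h z" for z using m[of k "W z"] mp[of k "W z"] by (simp add: h_def)
    have h2: "h z \<le> real (Suc k)" for z
    proof -
      have "1 / m k (W z) \<le> 1 / \<epsilon> k" using m(1)[of k "W z"] \<epsilon>(1)[of k] by (intro divide_left_mono) (auto simp: mp)
      then show ?thesis by (simp add: h_def \<epsilon>_def)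
    qed
    have ent: "C + (LINT z|circle_lebesgue. cos_weight z * ln (h z)) \<le> (LINT z|M. cos_weight z * h z)"
      by (rule entropy_bound_measurable[OF C hm _ h1 h2]) simp
    have hint: "integrable M (\<lambda>z. cos_weight z * h z)"
    proof (rule integrable_bounded_circle[OF circle_measure_axioms, of _ "8 * real (Suc k)"])
      fix z :: complex assume z: "norm z = 1"
      show "\<bar>cos_weight z * h z\<bar> \<le> 8 * real (Suc k)"
        unfolding abs_mult using cos_weight_bounds[OF z] h1[of z] h2[of z]
        by (intro mult_mono) auto
    qed measurable
    have "ennreal (LINT z|M. cos_weight z * h z) = (\<integral>\<^sup>+z. ennreal (cos_weight z * h z) \<partial>M)"
    proof (rule nn_integral_eq_integral[OF hint, symmetric])
      show "AE z in M. 0 \<le> cos_weight z * h z"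
        using AE_norm
      proof eventually_elim
        case (elim z)
        then show ?case using cos_weight_bounds(1)[of z] h1[of z] by simp
      qed
    qed
    also have "\<dots> \<le> (\<integral>\<^sup>+z. 8 + ennreal (8 * h z) * indicator (- A) z \<partial>M)"
    proof (intro nn_integral_mono_AE)
      show "AE z in M. ennreal (cos_weight z * h z) \<le> 8 + ennreal (8 * h z) * indicator (- A) z"
        using AE_norm
      proof eventually_elim
        case (elim z)
        have "ennreal (cos_weight z * h z) \<le> ennreal (8 * h z)"
          using cos_weight_bounds[OF elim] h1[of z] by (intro ennreal_leI mult_right_mono) auto
        moreover have "ennreal (8 * h z) = 8" if "z \<in> A" using that by (simp add: h_def)
        ultimately show ?case by (cases "z \<in> A") (auto intro: order.trans)
      qed
    qed
    also have "\<dots> = 8 + (\<integral>\<^sup>+z. ennreal (8 * h z) * indicator (- A) z \<partial>M)"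
      using emeasure_M by (subst nn_integral_add) auto
    also have "(\<integral>\<^sup>+z. ennreal (8 * h z) * indicator (- A) z \<partial>M)
        = (\<integral>\<^sup>+z. ennreal (8 * h z) \<partial>density M (indicator (- A)))"
      by (subst nn_integral_density) (auto simp: mult.commute)
    also have "\<dots> = (\<integral>\<^sup>+z. ennreal (8 * h z) * indicator (- A) z \<partial>Mac)"
      unfolding dens by (subst nn_integral_density) (auto simp: mult.commute)
    also have "\<dots> = (\<integral>\<^sup>+\<theta>. ennreal (w \<theta>) * (ennreal (8 * h (cis \<theta>)) * indicator (- A) (cis \<theta>)) \<partial>angle_measure)"
      by (rule nn_integral_Mac) measurable
    also have "\<dots> \<le> (\<integral>\<^sup>+\<theta>. 8 + ennreal (8 * w \<theta>) \<partial>angle_measure)"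
    proof (intro nn_integral_mono_AE)
      show "AE \<theta> in angle_measure. ennreal (w \<theta>) * (ennreal (8 * h (cis \<theta>)) * indicator (- A) (cis \<theta>))
          \<le> 8 + ennreal (8 * w \<theta>)"
        using AE_w AE_A
      proof eventually_elim
        case (elim \<theta>)
        have "w \<theta> / m k (w \<theta>) \<le> 1 + w \<theta>"
        proof (cases "w \<theta> \<le> 1")
          case True
          then have "w \<theta> \<le> m k (w \<theta>)" by (simp add: m_def)
          then have "w \<theta> / m k (w \<theta>) \<le> 1" using mp[of k "w \<theta>"] by simp
          then show ?thesis using elim by linarith
        next
          case False
          then have "m k (w \<theta>) = 1" using \<epsilon>(2)[of k] by (simp add: m_def)
          then show ?thesis by simp
        qed
        moreover have "w \<theta> * (8 * h (cis \<theta>)) = 8 * (w \<theta> / m k (w \<theta>))"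
          using elim by (simp add: h_def)
        ultimately have "w \<theta> * (8 * h (cis \<theta>)) \<le> 8 + 8 * w \<theta>" by linarith
        then have "ennreal (w \<theta> * (8 * h (cis \<theta>))) \<le> ennreal (8 + 8 * w \<theta>)"
          by (rule ennreal_leI)
        moreover have "ennreal (8 + 8 * w \<theta>) = 8 + ennreal (8 * w \<theta>)"
          using elim by (subst ennreal_plus) auto
        moreover have "ennreal (w \<theta> * (8 * h (cis \<theta>))) = ennreal (w \<theta>) * ennreal (8 * h (cis \<theta>))"
          using elim by (intro ennreal_mult') simp
        ultimately show ?case using elim by simp
      qed
    qed
    also have "\<dots> = 8 + (\<integral>\<^sup>+\<theta>. ennreal (8 * w \<theta>) \<partial>angle_measure)"
      using angle.emeasure_space_1 by (subst nn_integral_add) auto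
    also have "\<dots> \<le> 8 + 8" using nn_integral_8w by (intro add_left_mono)
    finally have "ennreal (LINT z|M. cos_weight z * h z) \<le> ennreal 24"
      by (simp add: add_left_mono add.assoc[symmetric])
    then have upper: "(LINT z|M. cos_weight z * h z) \<le> 24" by (subst (asm) ennreal_le_iff) simp_all
    have gm: "(\<lambda>z. cos_weight z * ln (h z)) \<in> borel_measurable borel" by measurable
    have "(LINT z|circle_lebesgue. cos_weight z * ln (h z)) = (LINT \<theta>|angle_measure. ?f \<theta> * ln (h (cis \<theta>)))"
      unfolding circle_lebesgue_def using gm by (subst integral_distr) (simp_all add: cos_weight_cis)
    also have "\<dots> = (LINT \<theta>|angle_measure. ?f \<theta> * - ln (m k (w \<theta>)))"
    proof (intro integral_cong_AE)
      show "AE \<theta> in angle_measure. ?f \<theta> * ln (h (cis \<theta>)) = ?f \<theta> * - ln (m k (w \<theta>))"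
        using AE_w AE_A
      proof eventually_elim
        case (elim \<theta>)
        then show ?case using mp[of k "w \<theta>"] by (simp add: h_def ln_div)
      qed
    qed (unfold m_def, measurable)
    finally have lower: "C + (LINT \<theta>|angle_measure. ?f \<theta> * - ln (m k (w \<theta>))) \<le> 24"
      using ent upper by linarith
    have "(\<integral>\<^sup>+\<theta>. ennreal (?f \<theta> * - ln (m k (w \<theta>))) \<partial>angle_measure)
        = ennreal (LINT \<theta>|angle_measure. ?f \<theta> * - ln (m k (w \<theta>)))"
    proof (rule nn_integral_eq_integral)
      have nl: "0 \<le> - ln (m k x)" "- ln (m k x) \<le> - ln (\<epsilon> k)" for x
        using m[of k x] mp[of k x] \<epsilon>(1)[of k] by simp_all
      show "integrable angle_measure (\<lambda>\<theta>. ?f \<theta> * - ln (m k (w \<theta>)))"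
      proof (rule angle.integrable_const_bound[of _ "8 * - ln (\<epsilon> k)"])
        have "norm (?f \<theta> * - ln (m k (w \<theta>))) \<le> 8 * - ln (\<epsilon> k)" for \<theta>
          unfolding real_norm_def abs_mult
          using cos_weight_cis_bounds[of \<theta>] nl[of "w \<theta>"] by (intro mult_mono) auto
        then show "AE \<theta> in angle_measure. norm (?f \<theta> * - ln (m k (w \<theta>))) \<le> 8 * - ln (\<epsilon> k)" by blast
      qed (unfold m_def, measurable)
      show "AE \<theta> in angle_measure. 0 \<le> ?f \<theta> * - ln (m k (w \<theta>))"
        using cos_weight_cis_bounds nl by (intro AE_I2 mult_nonneg_nonneg)
    qed
    also have "\<dots> \<le> ennreal (24 - C)" using lower by (intro ennreal_leI) linarith
    finally show ?thesis .
  qed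
  \<comment> \<open>Where w > 0 the lower cutoff is eventually inactive. Where w <= 0 the values ln
    (k + 1) tend to infinity and dominate if the weight is positive; if it is 0, so is the product 0
    * \<infinity>.\<close>
  have lim: "e2ennreal (- (ereal (?f \<theta>) * elog (w \<theta>))) \<le> liminf (\<lambda>k. ennreal (?f \<theta> * - ln (m k (w \<theta>))))" for \<theta>
  proof (cases "w \<theta> > 0")
    case True
    have "eventually (\<lambda>k. \<epsilon> k < min (w \<theta>) 1) sequentially"
      unfolding \<epsilon>_def
      by (rule order_tendstoD(2)[OF LIMSEQ_inverse_real_of_nat[unfolded inverse_eq_divide]]) (use True in simp)
    then have "eventually (\<lambda>k. e2ennreal (- (ereal (?f \<theta>) * elog (w \<theta>))) \<le> ennreal (?f \<theta> * - ln (m k (w \<theta>)))) sequentially"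
    proof eventually_elim
      case (elim k)
      then have "m k (w \<theta>) = min (w \<theta>) 1" by (simp add: m_def)
      then have "- ln (w \<theta>) \<le> - ln (m k (w \<theta>))" using True by simp
      then have "?f \<theta> * - ln (w \<theta>) \<le> ?f \<theta> * - ln (m k (w \<theta>))"
        by (rule mult_left_mono) (rule cos_weight_cis_bounds)
      then show ?case
        unfolding elog_mult_pos[OF True] by (simp add: ennreal_leI)
    qed
    then show ?thesis by (rule Liminf_bounded)
  next
    case False
    show ?thesis
    proof (cases "?f \<theta> = 0")
      case True
      then show ?thesis by (simp add: zero_ereal_def[symmetric])
    next
      case f: False
      then have fp: "?f \<theta> > 0" using cos_weight_cis_bounds(1)[of \<theta>] by linarith
      have "m k (w \<theta>) = \<epsilon> k" for k using False \<epsilon>(1)[of k] by (simp add: m_def)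
      then have eq: "?f \<theta> * - ln (m k (w \<theta>)) = ?f \<theta> * ln (real (Suc k))" for k
        by (simp add: \<epsilon>_def ln_div)
      have "filterlim (\<lambda>k. real (Suc k)) at_top sequentially"
        using filterlim_compose[OF filterlim_real_sequentially filterlim_Suc] by simp
      then have "filterlim (\<lambda>k. ?f \<theta> * ln (real (Suc k))) at_top sequentially"
        by (intro filterlim_tendsto_pos_mult_at_top[OF tendsto_const fp] filterlim_compose[OF ln_at_top])
      then have "(\<lambda>k. ennreal (?f \<theta> * ln (real (Suc k)))) \<longlonglongrightarrow> top"
        by (simp only: ennreal_tendsto_top_eq_at_top)
      then have "liminf (\<lambda>k. ennreal (?f \<theta> * - ln (m k (w \<theta>)))) = top"
        unfolding eq by (intro lim_imp_Liminf) simp_all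
      then show ?thesis by simp
    qed
  qed
  have "neg_part \<le> (\<integral>\<^sup>+\<theta>. liminf (\<lambda>k. ennreal (?f \<theta> * - ln (m k (w \<theta>)))) \<partial>angle_measure)"
    unfolding neg_part_def by (intro nn_integral_mono lim)
  also have "\<dots> \<le> liminf (\<lambda>k. \<integral>\<^sup>+\<theta>. ennreal (?f \<theta> * - ln (m k (w \<theta>))) \<partial>angle_measure)"
    by (rule nn_integral_liminf) (unfold m_def, measurable)
  also have "\<dots> \<le> liminf (\<lambda>k. ennreal (24 - C))"
    by (intro Liminf_mono always_eventually allI bound)
  also have "\<dots> < \<infinity>" by (simp add: Liminf_const)
  finally show ?thesis .
qed

end

theorem theorem4p35:
  fixes \<mu> \<mu>\<^sub>s :: "complex measure"
    and w :: "real \<Rightarrow> real"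
    and \<Phi> :: "nat \<Rightarrow> complex poly"
    and \<alpha> :: "nat \<Rightarrow> complex"
  assumes "nontrivial_circle_prob \<mu>"
    and "circle_lebesgue_decomposition \<mu> w \<mu>\<^sub>s"
    and "monic_opuc \<mu> \<Phi>"
    and "\<alpha> = verblunsky \<Phi>"
    and "(\<lambda>n. left_shift \<alpha> n - \<alpha> n) \<in> ell 1"
  shows "ext_integral angle_measure (\<lambda>\<theta>. ereal ((1 - cos \<theta>) ^ 3) * elog (w \<theta>)) > - \<infinity>
         \<longleftrightarrow> \<alpha> \<in> ell 8"
proof -
  interpret circle_measure \<mu> by (rule nontrivial_circle_measure) fact
  interpret verblunsky_seq \<alpha> by (rule monic_opuc_szego(1)[OF assms(1,3,4)])
  interpret prob_space \<mu> using assms(1) by (simp add: nontrivial_circle_prob_def)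
  interpret opuc_decomposition \<alpha> \<mu> w \<mu>\<^sub>s
    by unfold_locales
       (use monic_opuc_szego(3)[OF assms(1,3,4)] prob_space assms(2) in simp_all)
  have "summable (\<lambda>n. norm (\<alpha> (Suc n) - \<alpha> n))"
    using assms(5) by (simp add: ell_def left_shift_def)
  then have "(\<exists>C. \<forall>n. bs_entropy n \<ge> C) \<longleftrightarrow> \<alpha> \<in> ell 8" by (rule bs_entropy_bounded_below_iff)
  then show ?thesis
    unfolding ext_integral_iff using bs_entropy_bounded_below neg_part_finite by blast
qed

end
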